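(* Let $F\colon\mathsf{SKB}\to\mathsf{Grp}$ be the reflector from skew braces to groups. Any short exact sequence $$0\to K\to A\xrightarrow{\,f\,}B\to 0$$ in the variety $\mathsf{SKB}$ of skew braces induces an exact sequence in $\mathsf{Grp}$ $$\mathsf{H}_2(A,F)\xrightarrow{\mathsf{H}_2(f)}\mathsf{H}_2(B,F)\to\frac{K}{[K,A]_{\mathsf{Grp}}}\to\mathsf{H}_1(A,F)\xrightarrow{\mathsf{H}_1(f)}\mathsf{H}_1(B,F)\to 0.$$
   Context: A skew brace is a triple $(A,+,\circ)$ where $(A,+)$ and $(A,\circ)$ are groups such that $a\circ(b+c)=a\circ b-a+a\circ c$ for all $a,b,c\in A$. Put $a*b=-a+a\circ b-b$. An ideal of $A$ is a normal subgroup $I$ of $(A,+)$ with $a*x, x*a\in I$ for all $a\in A$, $x\in I$. A short exact sequence $0\to K\to A\to B\to 0$ in $\mathsf{SKB}$ means $f\colon A\to B$ is a surjective homomorphism with kernel $K$ (an ideal of $A$). For an ideal $I$ of $A$, $[I,A]_{\mathsf{Grp}}$ is the subgroup of $(A,+)$ generated by $\{a*b,\ b*a,\ c+b*a-c\mid a\in I,\ b,c\in A\}$; it is an ideal of $A$, contained in $I$. $\mathsf{Grp}$ is identified with the full subcategory of $\mathsf{SKB}$ of skew braces whose two operations coincide; the reflector $F$, left adjoint to the inclusion, is $F(A)=A/(A*A)$, where $A*A$ is the additive subgroup generated by all $a*b$. Comonadic homology: let $\mathbb{G}=(G,\epsilon,\delta)$ be the comonad on $\mathsf{SKB}$ induced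 by the adjunction between the forgetful functor to sets and the free skew brace functor, so $G(B)$ is the free skew brace on the underlying set of $B$ and $\epsilon_B\colon G(B)\to B$ is the canonical surjection. It yields a simplicial object $\mathbb{G}(B)$ with $n$-th term $G^{n+1}(B)$ and faces $d_i=G^{i}(\epsilon_{G^{n-i}(B)})$, $0\le i\le n$. Apply $F$ degreewise to get a simplicial object in $\mathsf{Grp}$ and take its Moore normalization $N$ (the chain complex whose $n$-th term is the intersection of the kernels of all but one extreme face map, with differential the remaining face). Then $\mathsf{H}_n(B,F)$, $n\ge1$, is the homology of $N(F(\mathbb{G}(B)))$ in degree $n-1$; it is functorial in $B$, and $\mathsf{H}_n(f)$ denotes the map induced by $f$. Explicitly, $\mathsf{H}_1(B,F)\cong B/[B,B]_{\mathsf{Grp}}$ and, for $P=G(B)$ and $L=\operatorname{Ker}(\epsilon_B)$, $\mathsf{H}_2(B,F)\cong (L\cap[P,P]_{\mathsf{Grp}})/[L,P]_{\mathsf{Grp}}$. *)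

theory Defs
  imports "HOL-Algebra.Generated_Groups" "HOL-Algebra.Ring"
begin

section \<open>Skew braces\<close>

text \<open>
  The record type of rings is used as the carrier of the signature: \<open>\<oplus>, \<zero>\<close> is the additive
  group of the skew brace (written additively, but not assumed commutative), and \<open>\<otimes>, \<one>\<close> is the
  group with operation \<open>\<circ>\<close>.
\<close>

definition skew_brace :: "('a, 'm) ring_scheme \<Rightarrow> bool" where
  "skew_brace A \<longleftrightarrow> group (add_monoid A) \<and> group A \<and>
     (\<forall>a \<in> carrier A. \<forall>b \<in> carrier A. \<forall>c \<in> carrier A.
        a \<otimes>\<^bsub>A\<^esub> (b \<oplus>\<^bsub>A\<^esub> c) = ((a \<otimes>\<^bsub>A\<^esub> b) \<ominus>\<^bsub>A\<^esub> a) \<oplus>\<^bsub>A\<^esub> (a \<otimes>\<^bsub>A\<^esub> c))"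

definition sb_hom :: "('a, 'm) ring_scheme \<Rightarrow> ('b, 'n) ring_scheme \<Rightarrow> ('a \<Rightarrow> 'b) set" where
  "sb_hom A B = hom (add_monoid A) (add_monoid B) \<inter> hom A B"

definition sb_kernel :: "('a, 'm) ring_scheme \<Rightarrow> ('b, 'n) ring_scheme \<Rightarrow> ('a \<Rightarrow> 'b) \<Rightarrow> 'a set" where
  "sb_kernel A B f = kernel (add_monoid A) (add_monoid B) f"

definition star :: "('a, 'm) ring_scheme \<Rightarrow> 'a \<Rightarrow> 'a \<Rightarrow> 'a" where
  "star A a b = ((\<ominus>\<^bsub>A\<^esub> a) \<oplus>\<^bsub>A\<^esub> (a \<otimes>\<^bsub>A\<^esub> b)) \<ominus>\<^bsub>A\<^esub> b"

definition star_square :: "('a, 'm) ring_scheme \<Rightarrow> 'a set" where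
  "star_square A = generate (add_monoid A) {star A a b | a b. a \<in> carrier A \<and> b \<in> carrier A}"

definition comm_Grp :: "('a, 'm) ring_scheme \<Rightarrow> 'a set \<Rightarrow> 'a set" where
  "comm_Grp A I = generate (add_monoid A)
     ({star A a b | a b. a \<in> I \<and> b \<in> carrier A}
      \<union> {star A b a | a b. a \<in> I \<and> b \<in> carrier A}
      \<union> {(c \<oplus>\<^bsub>A\<^esub> star A b a) \<ominus>\<^bsub>A\<^esub> c | a b c. a \<in> I \<and> b \<in> carrier A \<and> c \<in> carrier A})"

definition quot_comm_Grp :: "('a, 'm) ring_scheme \<Rightarrow> 'a set \<Rightarrow> 'a set monoid" where
  "quot_comm_Grp A K = (add_monoid A)\<lparr>carrier := K\<rparr> Mod comm_Grp A K"


section \<open>The reflector to groups\<close>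

text \<open>
  A skew brace whose two operations coincide is represented by its underlying group, so the
  reflection \<open>A / (A * A)\<close> is the additive quotient group.
\<close>

definition refl_obj :: "('a, 'm) ring_scheme \<Rightarrow> 'a set monoid" where
  "refl_obj A = add_monoid A Mod star_square A"

text \<open>
  The map into \<open>H / N\<close> induced by \<open>f\<close>: it sends a coset \<open>C\<close> to the coset of \<open>N\<close> containing
  \<open>f ` C\<close>, provided \<open>f\<close> maps the subgroup factored out of the source into \<open>N\<close>.
\<close>

definition quot_map :: "('b, 'n) monoid_scheme \<Rightarrow> 'b set \<Rightarrow> ('a \<Rightarrow> 'b) \<Rightarrow> 'a set \<Rightarrow> 'b set" where
  "quot_map H N f C = N <#>\<^bsub>H\<^esub> (f ` C)"

definition refl_map :: "('b, 'n) ring_scheme \<Rightarrow> ('a \<Rightarrow> 'b) \<Rightarrow> 'a set \<Rightarrow> 'b set" where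
  "refl_map B f = quot_map (add_monoid B) (star_square B) f"


section \<open>Free skew braces\<close>

datatype 'x sb_term =
    Var 'x
  | Zero | Add "'x sb_term" "'x sb_term" | Neg "'x sb_term"
  | One | Circ "'x sb_term" "'x sb_term" | Inv "'x sb_term"

inductive sb_eq :: "'x sb_term \<Rightarrow> 'x sb_term \<Rightarrow> bool" where
  refl: "sb_eq t t"
| sym: "sb_eq s t \<Longrightarrow> sb_eq t s"
| trans: "sb_eq s t \<Longrightarrow> sb_eq t u \<Longrightarrow> sb_eq s u"
| Add_cong: "sb_eq s s' \<Longrightarrow> sb_eq t t' \<Longrightarrow> sb_eq (Add s t) (Add s' t')"
| Neg_cong: "sb_eq s s' \<Longrightarrow> sb_eq (Neg s) (Neg s')"
| Circ_cong: "sb_eq s s' \<Longrightarrow> sb_eq t t' \<Longrightarrow> sb_eq (Circ s t) (Circ s' t')"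
| Inv_cong: "sb_eq s s' \<Longrightarrow> sb_eq (Inv s) (Inv s')"
| Add_assoc: "sb_eq (Add (Add s t) u) (Add s (Add t u))"
| Add_Zero: "sb_eq (Add Zero s) s"
| Add_Neg: "sb_eq (Add (Neg s) s) Zero"
| Circ_assoc: "sb_eq (Circ (Circ s t) u) (Circ s (Circ t u))"
| Circ_One: "sb_eq (Circ One s) s"
| Circ_Inv: "sb_eq (Circ (Inv s) s) One"
| brace: "sb_eq (Circ s (Add t u)) (Add (Add (Circ s t) (Neg s)) (Circ s u))"

quotient_type 'x fsb = "'x sb_term" / sb_eq
  by (intro equivpI reflpI sympI transpI) (fact sb_eq.refl, erule sb_eq.sym, erule (1) sb_eq.trans)

lift_definition fsb_zero :: "'x fsb" is Zero .
lift_definition fsb_add :: "'x fsb \<Rightarrow> 'x fsb \<Rightarrow> 'x fsb" is Add by (rule sb_eq.Add_cong)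
lift_definition fsb_neg :: "'x fsb \<Rightarrow> 'x fsb" is Neg by (rule sb_eq.Neg_cong)
lift_definition fsb_one :: "'x fsb" is One .
lift_definition fsb_circ :: "'x fsb \<Rightarrow> 'x fsb \<Rightarrow> 'x fsb" is Circ by (rule sb_eq.Circ_cong)
lift_definition fsb_inv :: "'x fsb \<Rightarrow> 'x fsb" is Inv by (rule sb_eq.Inv_cong)
lift_definition fsb_var :: "'x \<Rightarrow> 'x fsb" is Var .

lemma sb_eq_map: "sb_eq s t \<Longrightarrow> sb_eq (map_sb_term g s) (map_sb_term g t)"
proof (induction rule: sb_eq.induct)
  case (sym s t)
  show ?case by (rule sb_eq.sym[OF sym.IH])
next
  case (trans s t u)
  show ?case by (rule sb_eq.trans[OF trans.IH])
qed (simp_all add: sb_eq.refl sb_eq.Add_cong sb_eq.Neg_cong sb_eq.Circ_cong sb_eq.Inv_cong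
  sb_eq.Add_assoc sb_eq.Add_Zero sb_eq.Add_Neg sb_eq.Circ_assoc sb_eq.Circ_One sb_eq.Circ_Inv
  sb_eq.brace)

lift_definition fsb_map :: "('x \<Rightarrow> 'y) \<Rightarrow> 'x fsb \<Rightarrow> 'y fsb" is map_sb_term
  by (rule sb_eq_map)

definition free_sb :: "'x set \<Rightarrow> 'x fsb ring" where
  "free_sb X = \<lparr>carrier = {abs_fsb t | t. set_sb_term t \<subseteq> X},
     mult = fsb_circ, one = fsb_one, zero = fsb_zero, add = fsb_add\<rparr>"

primrec sb_eval :: "('a, 'm) ring_scheme \<Rightarrow> ('x \<Rightarrow> 'a) \<Rightarrow> 'x sb_term \<Rightarrow> 'a" where
  "sb_eval B g (Var x) = g x"
| "sb_eval B g Zero = \<zero>\<^bsub>B\<^esub>"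
| "sb_eval B g (Add s t) = sb_eval B g s \<oplus>\<^bsub>B\<^esub> sb_eval B g t"
| "sb_eval B g (Neg s) = \<ominus>\<^bsub>B\<^esub> sb_eval B g s"
| "sb_eval B g One = \<one>\<^bsub>B\<^esub>"
| "sb_eval B g (Circ s t) = sb_eval B g s \<otimes>\<^bsub>B\<^esub> sb_eval B g t"
| "sb_eval B g (Inv s) = inv\<^bsub>B\<^esub> sb_eval B g s"

text \<open>
  The homomorphism from the free skew brace on \<open>X\<close> to \<open>B\<close> that extends \<open>g\<close>. Its value does not
  depend on the chosen representative, by \<open>free_sb_ext_abs\<close> below.
\<close>

definition free_sb_ext :: "'x set \<Rightarrow> ('a, 'm) ring_scheme \<Rightarrow> ('x \<Rightarrow> 'a) \<Rightarrow> 'x fsb \<Rightarrow> 'a" where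
  "free_sb_ext X B g q = sb_eval B g (SOME t. set_sb_term t \<subseteq> X \<and> abs_fsb t = q)"

lemma group_sb_ops:
  assumes "skew_brace B"
  shows "group (add_monoid B)" "group B"
  using assms by (auto simp: skew_brace_def)

lemma a_inv_closed_sb: "skew_brace B \<Longrightarrow> a \<in> carrier B \<Longrightarrow> \<ominus>\<^bsub>B\<^esub> a \<in> carrier B"
  using group.inv_closed[OF group_sb_ops(1), of B a] by (simp add: a_inv_def)

lemma add_closed_sb:
  "skew_brace B \<Longrightarrow> a \<in> carrier B \<Longrightarrow> b \<in> carrier B \<Longrightarrow> a \<oplus>\<^bsub>B\<^esub> b \<in> carrier B"
  using monoid.m_closed[OF group.is_monoid[OF group_sb_ops(1)], of B a b] by simp

lemma zero_closed_sb: "skew_brace B \<Longrightarrow> \<zero>\<^bsub>B\<^esub> \<in> carrier B"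
  using monoid.one_closed[OF group.is_monoid[OF group_sb_ops(1)], of B] by simp

lemmas sb_closed = a_inv_closed_sb add_closed_sb zero_closed_sb
  group.inv_closed[OF group_sb_ops(2)]
  monoid.m_closed[OF group.is_monoid[OF group_sb_ops(2)]]
  monoid.one_closed[OF group.is_monoid[OF group_sb_ops(2)]]

lemma sb_eval_closed:
  assumes "skew_brace B" "g \<in> set_sb_term t \<rightarrow> carrier B"
  shows "sb_eval B g t \<in> carrier B"
  using assms(2) by (induction t) (auto intro!: sb_closed[OF assms(1)])

lemma sb_eval_eq:
  assumes B: "skew_brace B" and g: "\<And>x. g x \<in> carrier B" and "sb_eq s t"
  shows "sb_eval B g s = sb_eval B g t"
  using assms(3)
proof (induction rule: sb_eq.induct)
  case (Add_assoc s t u)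
  then show ?case
    using monoid.m_assoc[OF group.is_monoid[OF group_sb_ops(1)[OF B]],
        of "sb_eval B g s" "sb_eval B g t" "sb_eval B g u"]
    by (simp add: sb_eval_closed[OF B] g)
next
  case (Add_Zero s)
  then show ?case
    using monoid.l_one[OF group.is_monoid[OF group_sb_ops(1)[OF B]], of "sb_eval B g s"]
    by (simp add: sb_eval_closed[OF B] g)
next
  case (Add_Neg s)
  then show ?case
    using group.l_inv[OF group_sb_ops(1)[OF B], of "sb_eval B g s"]
    by (simp add: sb_eval_closed[OF B] g a_inv_def)
next
  case (Circ_assoc s t u)
  then show ?case
    by (simp add: sb_eval_closed[OF B] g monoid.m_assoc[OF group.is_monoid[OF group_sb_ops(2)[OF B]]])
next
  case (Circ_One s)
  then show ?case
    by (simp add: sb_eval_closed[OF B] g monoid.l_one[OF group.is_monoid[OF group_sb_ops(2)[OF B]]])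
next
  case (Circ_Inv s)
  then show ?case
    by (simp add: sb_eval_closed[OF B] g group.l_inv[OF group_sb_ops(2)[OF B]])
next
  case (brace s t u)
  then show ?case
    using B by (simp add: skew_brace_def sb_eval_closed[OF B] g a_minus_def)
qed simp_all

lemma free_sb_ext_abs:
  assumes B: "skew_brace B" and g: "g \<in> X \<rightarrow> carrier B" and t: "set_sb_term t \<subseteq> X"
  shows "free_sb_ext X B g (abs_fsb t) = sb_eval B g t"
proof -
  define s where "s = (SOME s. set_sb_term s \<subseteq> X \<and> abs_fsb s = abs_fsb t)"
  have s: "set_sb_term s \<subseteq> X \<and> abs_fsb s = abs_fsb t"
    unfolding s_def by (rule someI[of _ t]) (use t in simp)
  define h where "h = (\<lambda>x. if x \<in> X then g x else \<zero>\<^bsub>B\<^esub>)"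
  have h: "h x \<in> carrier B" for x
    using g by (auto simp: h_def intro: sb_closed B)
  have eq: "sb_eval B g u = sb_eval B h u" if "set_sb_term u \<subseteq> X" for u
    using that by (induction u) (auto simp: h_def)
  have "sb_eq s t"
    using s fsb.abs_eq_iff by blast
  then have "sb_eval B h s = sb_eval B h t"
    by (rule sb_eval_eq[OF B h])
  then show ?thesis
    using eq s t by (simp add: free_sb_ext_def flip: s_def)
qed

lemma fsb_axioms:
  "fsb_add (fsb_add a b) c = fsb_add a (fsb_add b c)"
  "fsb_add fsb_zero a = a"
  "fsb_add (fsb_neg a) a = fsb_zero"
  "fsb_circ (fsb_circ a b) c = fsb_circ a (fsb_circ b c)"
  "fsb_circ fsb_one a = a"
  "fsb_circ (fsb_inv a) a = fsb_one"
  "fsb_circ a (fsb_add b c) = fsb_add (fsb_add (fsb_circ a b) (fsb_neg a)) (fsb_circ a c)"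
  by (transfer; rule sb_eq.Add_assoc sb_eq.Add_Zero sb_eq.Add_Neg sb_eq.Circ_assoc
      sb_eq.Circ_One sb_eq.Circ_Inv sb_eq.brace)+

lemma free_sb_simps:
  "mult (free_sb X) = fsb_circ" "one (free_sb X) = fsb_one"
  "zero (free_sb X) = fsb_zero" "add (free_sb X) = fsb_add"
  by (simp_all add: free_sb_def)

lemma abs_fsb_mem: "set_sb_term t \<subseteq> X \<Longrightarrow> abs_fsb t \<in> carrier (free_sb X)"
  unfolding free_sb_def partial_object.simps by blast

lemma free_sb_cases:
  assumes "q \<in> carrier (free_sb X)"
  obtains t where "set_sb_term t \<subseteq> X" "q = abs_fsb t"
  using assms unfolding free_sb_def partial_object.simps by blast

lemma free_sb_closed:
  "fsb_zero \<in> carrier (free_sb X)"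
  "fsb_one \<in> carrier (free_sb X)"
  "a \<in> carrier (free_sb X) \<Longrightarrow> fsb_neg a \<in> carrier (free_sb X)"
  "a \<in> carrier (free_sb X) \<Longrightarrow> fsb_inv a \<in> carrier (free_sb X)"
  "a \<in> carrier (free_sb X) \<Longrightarrow> b \<in> carrier (free_sb X) \<Longrightarrow> fsb_add a b \<in> carrier (free_sb X)"
  "a \<in> carrier (free_sb X) \<Longrightarrow> b \<in> carrier (free_sb X) \<Longrightarrow> fsb_circ a b \<in> carrier (free_sb X)"
  by (elim free_sb_cases | simp add: abs_fsb_mem fsb_zero.abs_eq fsb_one.abs_eq
      fsb_neg.abs_eq fsb_inv.abs_eq fsb_add.abs_eq fsb_circ.abs_eq)+

lemma free_sb_groups: "group (add_monoid (free_sb X))" "group (free_sb X)"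
proof -
  show "group (add_monoid (free_sb X))"
  proof (rule groupI)
    fix a assume a: "a \<in> carrier (add_monoid (free_sb X))"
    show "\<exists>y \<in> carrier (add_monoid (free_sb X)).
        y \<otimes>\<^bsub>add_monoid (free_sb X)\<^esub> a = \<one>\<^bsub>add_monoid (free_sb X)\<^esub>"
      by (rule bexI[of _ "fsb_neg a"]) (use a in \<open>simp_all add: free_sb_simps free_sb_closed fsb_axioms\<close>)
  qed (simp_all add: free_sb_simps free_sb_closed fsb_axioms)
  show "group (free_sb X)"
  proof (rule groupI)
    fix a assume a: "a \<in> carrier (free_sb X)"
    show "\<exists>y \<in> carrier (free_sb X). y \<otimes>\<^bsub>free_sb X\<^esub> a = \<one>\<^bsub>free_sb X\<^esub>"
      by (rule bexI[of _ "fsb_inv a"]) (use a in \<open>simp_all add: free_sb_simps free_sb_closed fsb_axioms\<close>)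
  qed (simp_all add: free_sb_simps free_sb_closed fsb_axioms)
qed

lemma free_sb_inverses:
  assumes "a \<in> carrier (free_sb X)"
  shows "\<ominus>\<^bsub>free_sb X\<^esub> a = fsb_neg a" "inv\<^bsub>free_sb X\<^esub> a = fsb_inv a"
  unfolding a_inv_def
  by (rule group.inv_equality[OF free_sb_groups(1)] group.inv_equality[OF free_sb_groups(2)];
      use assms in \<open>simp add: free_sb_simps free_sb_closed fsb_axioms\<close>)+

lemma skew_brace_free_sb: "skew_brace (free_sb X)"
  unfolding skew_brace_def a_minus_def
  using free_sb_groups by (auto simp: free_sb_inverses free_sb_simps fsb_axioms(7))

lemma free_sb_ext_hom:
  assumes B: "skew_brace B" and g: "g \<in> X \<rightarrow> carrier B"
  shows "free_sb_ext X B g \<in> sb_hom (free_sb X) B"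
proof -
  have "free_sb_ext X B g q \<in> carrier B" if "q \<in> carrier (free_sb X)" for q
    using that g
    by (auto simp: free_sb_def free_sb_ext_abs[OF B g] Pi_iff subset_iff intro!: sb_eval_closed[OF B])
  moreover have "free_sb_ext X B g (fsb_add (abs_fsb s) (abs_fsb t)) =
        free_sb_ext X B g (abs_fsb s) \<oplus>\<^bsub>B\<^esub> free_sb_ext X B g (abs_fsb t)"
     "free_sb_ext X B g (fsb_circ (abs_fsb s) (abs_fsb t)) =
        free_sb_ext X B g (abs_fsb s) \<otimes>\<^bsub>B\<^esub> free_sb_ext X B g (abs_fsb t)"
    if "set_sb_term s \<subseteq> X" "set_sb_term t \<subseteq> X" for s t
    using that by (simp_all add: fsb_add.abs_eq fsb_circ.abs_eq free_sb_ext_abs[OF B g])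
  ultimately show ?thesis
    by (auto simp: sb_hom_def hom_def free_sb_def)
qed

lemma free_sb_ext_var:
  assumes "skew_brace B" "g \<in> X \<rightarrow> carrier B" "x \<in> X"
  shows "free_sb_ext X B g (fsb_var x) = g x"
  using free_sb_ext_abs[OF assms(1,2), of "Var x"] assms(3) by (simp add: fsb_var.abs_eq)

lemma free_sb_ext_unique:
  assumes B: "skew_brace B" and g: "g \<in> X \<rightarrow> carrier B"
    and h: "h \<in> sb_hom (free_sb X) B" and hg: "\<And>x. x \<in> X \<Longrightarrow> h (fsb_var x) = g x"
    and q: "q \<in> carrier (free_sb X)"
  shows "h q = free_sb_ext X B g q"
proof -
  note F = skew_brace_free_sb[of X]
  interpret a: group_hom "add_monoid (free_sb X)" "add_monoid B" h
    using group_sb_ops[OF F] group_sb_ops[OF B] h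
    by (auto simp: group_hom_def group_hom_axioms_def sb_hom_def)
  interpret m: group_hom "free_sb X" B h
    using group_sb_ops[OF F] group_sb_ops[OF B] h
    by (auto simp: group_hom_def group_hom_axioms_def sb_hom_def)
  have "h (abs_fsb t) = sb_eval B g t" if "set_sb_term t \<subseteq> X" for t
    using that
  proof (induction t)
    case (Var x)
    then show ?case using hg[of x] by (simp add: fsb_var.abs_eq)
  next
    case Zero
    then show ?case using a.hom_one by (simp add: free_sb_simps fsb_zero.abs_eq)
  next
    case (Add s t)
    then show ?case
      using a.hom_mult[of "abs_fsb s" "abs_fsb t"]
      by (simp add: free_sb_simps abs_fsb_mem fsb_add.abs_eq)
  next
    case (Neg t)
    then show ?case
      using a.hom_inv[of "abs_fsb t"] free_sb_inverses(1)[of "abs_fsb t" X]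
      by (simp add: abs_fsb_mem fsb_neg.abs_eq a_inv_def)
  next
    case One
    then show ?case using m.hom_one by (simp add: free_sb_simps fsb_one.abs_eq)
  next
    case (Circ s t)
    then show ?case
      using m.hom_mult[of "abs_fsb s" "abs_fsb t"]
      by (simp add: free_sb_simps abs_fsb_mem fsb_circ.abs_eq)
  next
    case (Inv t)
    then show ?case
      using m.hom_inv[of "abs_fsb t"] free_sb_inverses(2)[of "abs_fsb t" X]
      by (simp add: abs_fsb_mem fsb_inv.abs_eq)
  qed
  then show ?thesis
    using q by (auto elim!: free_sb_cases simp: free_sb_ext_abs[OF B g])
qed


section \<open>The free skew brace comonad\<close>

definition G_obj :: "('a, 'm) ring_scheme \<Rightarrow> 'a fsb ring" where
  "G_obj B = free_sb (carrier B)"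

definition counit :: "('a, 'm) ring_scheme \<Rightarrow> 'a fsb \<Rightarrow> 'a" where
  "counit B = free_sb_ext (carrier B) B (\<lambda>b. b)"

text \<open>
  On morphisms \<open>G\<close> acts by \<open>fsb_map\<close>. The terms \<open>X\<^sub>n = F (G\<^sup>n\<^sup>+\<^sup>1 B)\<close> of the simplicial group live
  in different types, so the part in degrees \<open>n \<le> 2\<close>, which determines the first two homology
  groups, is written out: \<open>faceni\<close> is \<open>F (d\<^sub>i)\<close> with \<open>d\<^sub>i = G\<^sup>i (\<epsilon>)\<close>, \<open>\<epsilon>\<close> the counit at
  \<open>G\<^sup>n\<^sup>-\<^sup>i B\<close>.
\<close>

definition X0 :: "('a, 'm) ring_scheme \<Rightarrow> 'a fsb set monoid" where
  "X0 B = refl_obj (G_obj B)"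

definition X1 :: "('a, 'm) ring_scheme \<Rightarrow> 'a fsb fsb set monoid" where
  "X1 B = refl_obj (G_obj (G_obj B))"

definition X2 :: "('a, 'm) ring_scheme \<Rightarrow> 'a fsb fsb fsb set monoid" where
  "X2 B = refl_obj (G_obj (G_obj (G_obj B)))"

definition face10 :: "('a, 'm) ring_scheme \<Rightarrow> 'a fsb fsb set \<Rightarrow> 'a fsb set" where
  "face10 B = refl_map (G_obj B) (counit (G_obj B))"

definition face11 :: "('a, 'm) ring_scheme \<Rightarrow> 'a fsb fsb set \<Rightarrow> 'a fsb set" where
  "face11 B = refl_map (G_obj B) (fsb_map (counit B))"

definition face20 :: "('a, 'm) ring_scheme \<Rightarrow> 'a fsb fsb fsb set \<Rightarrow> 'a fsb fsb set" where
  "face20 B = refl_map (G_obj (G_obj B)) (counit (G_obj (G_obj B)))"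

definition face21 :: "('a, 'm) ring_scheme \<Rightarrow> 'a fsb fsb fsb set \<Rightarrow> 'a fsb fsb set" where
  "face21 B = refl_map (G_obj (G_obj B)) (fsb_map (counit (G_obj B)))"

definition face22 :: "('a, 'm) ring_scheme \<Rightarrow> 'a fsb fsb fsb set \<Rightarrow> 'a fsb fsb set" where
  "face22 B = refl_map (G_obj (G_obj B)) (fsb_map (fsb_map (counit B)))"


section \<open>Moore normalization and homology\<close>

text \<open>
  The normalization is \<open>N\<^sub>n = \<Inter>\<^sub>i\<^sub><\<^sub>n ker d\<^sub>i\<close> with differential the last face \<open>d\<^sub>n\<close>; in particular
  \<open>N\<^sub>0 = X\<^sub>0\<close>.
\<close>

definition N1 :: "('a, 'm) ring_scheme \<Rightarrow> 'a fsb fsb set set" where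
  "N1 B = kernel (X1 B) (X0 B) (face10 B)"

definition N2 :: "('a, 'm) ring_scheme \<Rightarrow> 'a fsb fsb fsb set set" where
  "N2 B = kernel (X2 B) (X1 B) (face20 B) \<inter> kernel (X2 B) (X1 B) (face21 B)"

definition cycles1 :: "('a, 'm) ring_scheme \<Rightarrow> 'a fsb fsb set set" where
  "cycles1 B = kernel ((X1 B)\<lparr>carrier := N1 B\<rparr>) (X0 B) (face11 B)"

definition boundaries0 :: "('a, 'm) ring_scheme \<Rightarrow> 'a fsb set set" where
  "boundaries0 B = face11 B ` N1 B"

definition boundaries1 :: "('a, 'm) ring_scheme \<Rightarrow> 'a fsb fsb set set" where
  "boundaries1 B = face22 B ` N2 B"

text \<open>Note the degree shift: \<open>H\<^sub>n\<close> is the homology of the normalization in degree \<open>n - 1\<close>.\<close>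

definition H1 :: "('a, 'm) ring_scheme \<Rightarrow> 'a fsb set set monoid" where
  "H1 B = X0 B Mod boundaries0 B"

definition H2 :: "('a, 'm) ring_scheme \<Rightarrow> 'a fsb fsb set set monoid" where
  "H2 B = (X1 B)\<lparr>carrier := cycles1 B\<rparr> Mod boundaries1 B"

definition H1_map :: "('b, 'n) ring_scheme \<Rightarrow> ('a \<Rightarrow> 'b) \<Rightarrow> 'a fsb set set \<Rightarrow> 'b fsb set set" where
  "H1_map B f = quot_map (X0 B) (boundaries0 B) (refl_map (G_obj B) (fsb_map f))"

definition H2_map ::
    "('b, 'n) ring_scheme \<Rightarrow> ('a \<Rightarrow> 'b) \<Rightarrow> 'a fsb fsb set set \<Rightarrow> 'b fsb fsb set set" where
  "H2_map B f =
     quot_map (X1 B) (boundaries1 B) (refl_map (G_obj (G_obj B)) (fsb_map (fsb_map f)))"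

text \<open>
  The class in \<open>H\<^sub>1 A\<close> of an element \<open>x\<close> of \<open>G A\<close>. Under \<open>H\<^sub>1 A \<cong> A / [A, A]\<close>, the isomorphism
  induced by the counit, it corresponds to the class of \<open>\<epsilon> x\<close>.
\<close>

definition H1_class :: "('a, 'm) ring_scheme \<Rightarrow> 'a fsb \<Rightarrow> 'a fsb set set" where
  "H1_class A x =
     boundaries0 A #>\<^bsub>X0 A\<^esub> (star_square (G_obj A) #>\<^bsub>add_monoid (G_obj A)\<^esub> x)"

end

theory Submission
  imports Defs
begin

text \<open>
  Write \<open>P = G B\<close>, \<open>Q = G (G B)\<close> and \<open>L = Ker (\<epsilon>\<^sub>B)\<close>. If \<open>f: A \<rightarrow> B\<close> is a split epimorphism of
  skew braces with kernel \<open>M\<close>, then \<open>M \<inter> A * A = [M, A]\<close>. Applied to \<open>d\<^sub>0: Q \<rightarrow> P\<close>, this shows that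
  every class in \<open>H\<^sub>2 B\<close> is represented by some \<open>w \<in> Q\<close> with \<open>d\<^sub>0 w = 0\<close> and \<open>d\<^sub>1 w \<in> P * P\<close>, and that
  such a class is trivial iff \<open>d\<^sub>1 w \<in> [L, P]\<close> (the Hopf formula).

  For the connecting map, let \<open>W\<close> be the group of all \<open>w \<in> G (G A)\<close> such that \<open>G f\<close> kills \<open>d\<^sub>0 w\<close> and
  \<open>d\<^sub>1 w \<in> G A * G A\<close>. Both \<open>w \<mapsto> [G (G f) w] \<in> H\<^sub>2 B\<close> and \<open>w \<mapsto> [\<epsilon>\<^sub>A (d\<^sub>1 w)] \<in> K / [K, A]\<close> are
  homomorphisms, the first is onto, and its kernel lies in the kernel of the second because \<open>G f\<close> is
  again a split epimorphism. The second thus factors through the first, and exactness is read off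
  on \<open>W\<close>.
\<close>

section \<open>Quotients and homomorphisms of groups\<close>

lemma (in normal) coset_eq_one_iff:
  assumes x: "x \<in> carrier G"
  shows "H #> x = \<one>\<^bsub>G Mod H\<^esub> \<longleftrightarrow> x \<in> H"
  unfolding FactGroup_def monoid.simps
proof
  assume "H #> x = H"
  then show "x \<in> H" using x subgroup_axioms by (rule coset_join1)
next
  assume "x \<in> H"
  then show "H #> x = H" by (rule coset_join2[OF x subgroup_axioms])
qed

lemma (in normal) group_hom_coset: "group_hom G (G Mod H) (\<lambda>x. H #> x)"
  using r_coset_hom_Mod factorgroup_is_group
  by (simp add: group_hom_def group_hom_axioms_def is_group)

lemma (in group) mult_inv_eq_one_iff:
  assumes "x \<in> carrier G" "y \<in> carrier G"
  shows "x \<otimes> inv y = \<one> \<longleftrightarrow> x = y"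
proof
  assume "x \<otimes> inv y = \<one>"
  then have "x \<otimes> inv y \<otimes> y = \<one> \<otimes> y" by simp
  then show "x = y" using assms by (simp add: m_assoc)
qed (use assms in simp)

text \<open>Each equation for \<delta> can be checked on preimages under \<open>p\<close>. This
  shows that maps given by \<open>quot_map\<close>, which act on whole cosets, are homomorphisms
  once their values on classes are known.\<close>

lemma group_hom_via_epi:
  assumes "group H" "group H'" and p: "group_hom G H p" "p ` carrier G = carrier H"
    and q: "group_hom G H' q" and \<delta>: "\<And>x. x \<in> carrier G \<Longrightarrow> \<delta> (p x) = q x"
  shows "group_hom H H' \<delta>"
proof -
  interpret p: group_hom G H p by (rule p(1))
  interpret q: group_hom G H' q by (rule q)
  have "\<delta> \<in> hom H H'"
  proof (rule homI)
    fix y assume "y \<in> carrier H"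
    then obtain x where "x \<in> carrier G" "y = p x" using p(2) by blast
    then show "\<delta> y \<in> carrier H'" by (simp add: \<delta>)
  next
    fix y y' assume "y \<in> carrier H" "y' \<in> carrier H"
    then obtain x x' where x: "x \<in> carrier G" "y = p x" "x' \<in> carrier G" "y' = p x'"
      using p(2) by blast
    then have "y \<otimes>\<^bsub>H\<^esub> y' = p (x \<otimes>\<^bsub>G\<^esub> x')" by simp
    then have "\<delta> (y \<otimes>\<^bsub>H\<^esub> y') = q (x \<otimes>\<^bsub>G\<^esub> x')"
      using x \<delta>[of "x \<otimes>\<^bsub>G\<^esub> x'"] by simp
    then show "\<delta> (y \<otimes>\<^bsub>H\<^esub> y') = \<delta> y \<otimes>\<^bsub>H'\<^esub> \<delta> y'" using x by (simp add: \<delta>)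
  qed
  then show ?thesis
    by (simp add: group_hom_def group_hom_axioms_def)
qed

text \<open>Two preimages of one element under \<open>p\<close> differ by an element that
  \<open>p\<close> kills, and \<open>q\<close> kills it too, so the choice of preimage in \<delta>
  is immaterial. Both maps of the exact sequence that touch K / [K, A] arise this way.\<close>

lemma group_hom_factor:
  assumes p: "group_hom G H p" "p ` carrier G = carrier H" and q: "group_hom G H' q"
    and ker: "\<And>x. x \<in> carrier G \<Longrightarrow> p x = \<one>\<^bsub>H\<^esub> \<Longrightarrow> q x = \<one>\<^bsub>H'\<^esub>"
  obtains \<delta> where "group_hom H H' \<delta>" "\<And>x. x \<in> carrier G \<Longrightarrow> \<delta> (p x) = q x"
proof -
  interpret p: group_hom G H p by (rule p(1))
  interpret q: group_hom G H' q by (rule q)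
  define \<delta> where "\<delta> y = q (SOME x. x \<in> carrier G \<and> p x = y)" for y
  have \<delta>: "\<delta> (p x) = q x" if x: "x \<in> carrier G" for x
  proof -
    define x' where "x' = (SOME x'. x' \<in> carrier G \<and> p x' = p x)"
    have x': "x' \<in> carrier G \<and> p x' = p x"
      unfolding x'_def by (rule someI[of _ x]) (use x in simp)
    then have "q (x' \<otimes>\<^bsub>G\<^esub> inv\<^bsub>G\<^esub> x) = \<one>\<^bsub>H'\<^esub>"
      using x by (intro ker) auto
    then have "q x' \<otimes>\<^bsub>H'\<^esub> inv\<^bsub>H'\<^esub> q x = \<one>\<^bsub>H'\<^esub>"
      using x x' by simp
    then have "q x' = q x"
      using x x' by (simp add: q.H.mult_inv_eq_one_iff)
    then show ?thesis by (simp add: \<delta>_def x'_def)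
  qed
  have "group_hom H H' \<delta>"
    by (rule group_hom_via_epi[OF p.H.is_group q.H.is_group p q]) (rule \<delta>)
  then show ?thesis using \<delta> by (rule that)
qed

lemma group_hom_comp:
  assumes "group_hom G H f" "group_hom H K g"
  shows "group_hom G K (\<lambda>x. g (f x))"
proof -
  interpret f: group_hom G H f by fact
  interpret g: group_hom H K g by fact
  show ?thesis
    by unfold_locales (auto simp: hom_def)
qed

lemma (in group_hom) normal_image:
  assumes surj: "h ` carrier G = carrier H" and N: "normal N G"
  shows "normal (h ` N) H"
proof (rule H.normal_invI)
  interpret N: normal N G by (rule N)
  show "subgroup (h ` N) H"
    using N.subgroup_axioms by (rule subgroup_img_is_subgroup)
  fix y z assume "y \<in> carrier H" "z \<in> h ` N"
  then obtain x n where x: "x \<in> carrier G" "y = h x" "n \<in> N" "z = h n"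
    using surj by blast
  then have eq: "y \<otimes>\<^bsub>H\<^esub> z \<otimes>\<^bsub>H\<^esub> inv\<^bsub>H\<^esub> y = h (x \<otimes> n \<otimes> inv x)"
    by simp
  show "y \<otimes>\<^bsub>H\<^esub> z \<otimes>\<^bsub>H\<^esub> inv\<^bsub>H\<^esub> y \<in> h ` N"
    unfolding eq using x N.inv_op_closed2 by (intro imageI)
qed

lemma (in group_hom) restrict_group_hom:
  assumes "subgroup S G" "subgroup T H" "h ` S \<subseteq> T"
  shows "group_hom (G\<lparr>carrier := S\<rparr>) (H\<lparr>carrier := T\<rparr>) h"
proof -
  have "S \<subseteq> carrier G" using assms(1) by (rule subgroup.subset)
  then have "h \<in> hom (G\<lparr>carrier := S\<rparr>) (H\<lparr>carrier := T\<rparr>)"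
    using assms(3) by (auto simp: hom_def subset_iff)
  then show ?thesis
    using subgroup.subgroup_is_group[OF assms(1) G.is_group]
      subgroup.subgroup_is_group[OF assms(2) H.is_group]
    by (simp add: group_hom_def group_hom_axioms_def)
qed

lemma (in normal) coset_surj: "(\<lambda>x. H #> x) ` carrier G = carrier (G Mod H)"
  by (auto simp: FactGroup_def RCOSETS_def)

text \<open>A coset depends only on the multiplication, so cosets in a subgroup such as the cycles
  or the kernel of \<open>f\<close> are literally cosets in the ambient group.\<close>

lemma r_coset_carrier_update [simp]: "N #>\<^bsub>G\<lparr>carrier := S\<rparr>\<^esub> x = N #>\<^bsub>G\<^esub> x"
  by (simp add: r_coset_def)

text \<open>\<open>M\<close> absorbs the image of \<open>N\<close>, so the set product in
  \<open>quot_map\<close> collapses to a single coset.\<close>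

lemma (in group_hom) quot_map_coset:
  assumes "subgroup N G" "subgroup M H" "h ` N \<subseteq> M" "x \<in> carrier G"
  shows "quot_map H M h (N #> x) = M #>\<^bsub>H\<^esub> h x"
proof -
  interpret N: subgroup N G by fact
  interpret M: subgroup M H by fact
  have "m \<otimes>\<^bsub>H\<^esub> h (n \<otimes> x) \<in> M #>\<^bsub>H\<^esub> h x" if "m \<in> M" "n \<in> N" for m n
  proof -
    have "m \<otimes>\<^bsub>H\<^esub> h (n \<otimes> x) = (m \<otimes>\<^bsub>H\<^esub> h n) \<otimes>\<^bsub>H\<^esub> h x"
      using that assms(4) by (simp add: H.m_assoc)
    moreover have "m \<otimes>\<^bsub>H\<^esub> h n \<in> M"
      using that assms(3) by blast
    ultimately show ?thesis by (auto simp: r_coset_def)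
  qed
  moreover have "m \<otimes>\<^bsub>H\<^esub> h x \<in> quot_map H M h (N #> x)" if "m \<in> M" for m
  proof -
    have "\<one> \<otimes> x \<in> N #> x"
      by (auto simp: r_coset_def)
    then have "h x \<in> h ` (N #> x)"
      using assms(4) by simp
    then show ?thesis
      using that unfolding quot_map_def set_mult_def by blast
  qed
  ultimately show ?thesis
    by (auto simp: quot_map_def set_mult_def r_coset_def)
qed

lemma (in group_hom) restrict_domain:
  assumes "subgroup S G"
  shows "group_hom (G\<lparr>carrier := S\<rparr>) H h"
proof -
  have "S \<subseteq> carrier G" using assms by (rule subgroup.subset)
  then have "h \<in> hom (G\<lparr>carrier := S\<rparr>) H"
    by (auto simp: hom_def subset_iff)
  then show ?thesis
    using subgroup.subgroup_is_group[OF assms G.is_group]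
    by (simp add: group_hom_def group_hom_axioms_def)
qed

section \<open>Commutator ideals of skew braces\<close>

locale sb =
  fixes A :: "('a, 'm) ring_scheme" (structure)
  assumes skew_brace: "skew_brace A"

sublocale sb \<subseteq> add: group "add_monoid A"
  rewrites "carrier (add_monoid A) = carrier A"
    and "mult (add_monoid A) = add A"
    and "one (add_monoid A) = zero A"
    and "m_inv (add_monoid A) = a_inv A"
  using group_sb_ops(1)[OF skew_brace] by (auto simp: a_inv_def)

sublocale sb \<subseteq> mul: group A
  using group_sb_ops(2)[OF skew_brace] .

context sb
begin

lemma a_minus_closed [simp, intro]: "x \<in> carrier A \<Longrightarrow> y \<in> carrier A \<Longrightarrow> x \<ominus> y \<in> carrier A"
  by (simp add: a_minus_def)

lemma add_cancel:
  assumes "x \<in> carrier A" "y \<in> carrier A"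
  shows "x \<oplus> (\<ominus> x \<oplus> y) = y" "\<ominus> x \<oplus> (x \<oplus> y) = y"
  using assms by (simp_all flip: add.m_assoc)

text \<open>Bracketed to the right, to agree with rewriting by \<open>add.m_assoc\<close>.\<close>

lemma brace:
  "a \<in> carrier A \<Longrightarrow> b \<in> carrier A \<Longrightarrow> c \<in> carrier A \<Longrightarrow>
    a \<otimes> (b \<oplus> c) = a \<otimes> b \<oplus> (\<ominus> a \<oplus> a \<otimes> c)"
  using skew_brace by (simp add: skew_brace_def a_minus_def add.m_assoc)

text \<open>The brace axiom at b = c = 0 reads a \<circ> 0 = a \<circ> 0 - a + a \<circ> 0, and
  cancelling leaves - a + a \<circ> 0 = 0.\<close>

lemma circ_zero:
  assumes a: "a \<in> carrier A"
  shows "a \<otimes> \<zero> = a"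
proof -
  have "a \<otimes> \<zero> \<oplus> (\<ominus> a \<oplus> a \<otimes> \<zero>) = a \<otimes> \<zero> \<oplus> \<zero>"
    using brace[OF a add.one_closed add.one_closed] a by simp
  then have "\<ominus> a \<oplus> a \<otimes> \<zero> = \<zero>"
    using a by simp
  then show ?thesis
    using a add_cancel(1)[of a "a \<otimes> \<zero>"] by simp
qed

text \<open>The product \<open>\<one> \<otimes> \<zero>\<close> is \<zero> because \<one> is
  neutral, and \<one> by \<open>circ_zero\<close>.\<close>

lemma one_eq_zero: "\<one> = \<zero>"
  using circ_zero[OF mul.one_closed] by simp

lemma zero_circ: "a \<in> carrier A \<Longrightarrow> \<zero> \<otimes> a = a"
  using mul.l_one[of a] unfolding one_eq_zero .

lemma star_closed [simp]: "a \<in> carrier A \<Longrightarrow> b \<in> carrier A \<Longrightarrow> star A a b \<in> carrier A"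
  by (simp add: star_def)

lemma circ_conv_star:
  "a \<in> carrier A \<Longrightarrow> b \<in> carrier A \<Longrightarrow> a \<otimes> b = a \<oplus> (star A a b \<oplus> b)"
  by (simp add: star_def a_minus_def add.m_assoc add_cancel)

text \<open>The brace axiom makes \<open>star A a\<close> a derivation twisted by conjugation. Read
  backwards, it writes the conjugate b + a * c - b as - (a * b) + a * (b + c), which is how
  conjugates of stars are controlled below.\<close>

lemma star_add:
  assumes "a \<in> carrier A" "b \<in> carrier A" "c \<in> carrier A"
  shows "star A a (b \<oplus> c) = star A a b \<oplus> (b \<oplus> star A a c \<ominus> b)"
  using assms
  by (simp add: star_def a_minus_def brace add.m_assoc add_cancel add.inv_mult_group)

lemma star_circ:
  assumes "a \<in> carrier A" "b \<in> carrier A" "c \<in> carrier A"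
  shows "star A (a \<otimes> c) b = star A a (star A c b) \<oplus> (star A c b \<oplus> star A a b)"
proof -
  \<comment> \<open>By \<open>star_add\<close> the right-hand side of the claim contracts to a * (c
    * b + b) + c * b, and c * b + b is - c + c \<circ> b.\<close>
  have "star A a (star A c b) \<oplus> (star A c b \<oplus> star A a b) = star A a (star A c b \<oplus> b) \<oplus> star A c b"
    using assms by (simp add: star_add a_minus_def add.m_assoc)
  also have "star A c b \<oplus> b = \<ominus> c \<oplus> c \<otimes> b"
    using assms by (simp add: circ_conv_star add_cancel)
  also have "star A a (\<ominus> c \<oplus> c \<otimes> b) = \<ominus> a \<oplus> (a \<otimes> (\<ominus> c \<oplus> c \<otimes> b)) \<oplus> \<ominus> (\<ominus> c \<oplus> c \<otimes> b)"
    by (simp add: star_def a_minus_def)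
  also have "a \<otimes> (\<ominus> c \<oplus> c \<otimes> b) = a \<oplus> (\<ominus> (a \<otimes> c) \<oplus> a \<otimes> (c \<otimes> b))"
  proof -
    \<comment> \<open>The value of a \<circ> (- c) comes from expanding a = a \<circ> (c -
      c).\<close>
    have "a = a \<otimes> (c \<oplus> \<ominus> c)"
      using assms by (simp add: circ_zero)
    also have "\<dots> = a \<otimes> c \<oplus> (\<ominus> a \<oplus> a \<otimes> (\<ominus> c))"
      using assms by (subst brace) auto
    finally have "a \<otimes> c \<oplus> (\<ominus> a \<oplus> a \<otimes> (\<ominus> c)) = a" ..
    then have "a \<otimes> (\<ominus> c) = a \<oplus> (\<ominus> (a \<otimes> c) \<oplus> a)"
      by (metis add_cancel assms(1,3) add.inv_closed mul.m_closed add.m_closed)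
    then show ?thesis
      using assms by (simp add: brace add.m_assoc add_cancel)
  qed
  also have "\<ominus> a \<oplus> (a \<oplus> (\<ominus> (a \<otimes> c) \<oplus> a \<otimes> (c \<otimes> b))) \<oplus> \<ominus> (\<ominus> c \<oplus> c \<otimes> b) \<oplus> star A c b
      = star A (a \<otimes> c) b"
    using assms
    by (simp add: star_def a_minus_def add.m_assoc add_cancel add.inv_mult_group mul.m_assoc)
  finally show ?thesis ..
qed

section \<open>Commutator ideals: generators and normality\<close>

abbreviation comm_gens where
  "comm_gens I \<equiv> {star A a b | a b. a \<in> I \<and> b \<in> carrier A}
      \<union> {star A b a | a b. a \<in> I \<and> b \<in> carrier A}
      \<union> {(c \<oplus> star A b a) \<ominus> c | a b c. a \<in> I \<and> b \<in> carrier A \<and> c \<in> carrier A}"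

lemma comm_gens_subset: "I \<subseteq> carrier A \<Longrightarrow> comm_gens I \<subseteq> carrier A"
  by auto

lemma subgroup_comm_Grp: "I \<subseteq> carrier A \<Longrightarrow> subgroup (comm_Grp A I) (add_monoid A)"
  unfolding comm_Grp_def using add.generate_is_subgroup[OF comm_gens_subset] .

lemma star_comm_Grp1: "a \<in> I \<Longrightarrow> b \<in> carrier A \<Longrightarrow> star A a b \<in> comm_Grp A I"
  unfolding comm_Grp_def by (rule generate.incl) blast

lemma star_comm_Grp3:
  "a \<in> I \<Longrightarrow> b \<in> carrier A \<Longrightarrow> c \<in> carrier A \<Longrightarrow> c \<oplus> star A b a \<ominus> c \<in> comm_Grp A I"
  unfolding comm_Grp_def by (rule generate.incl) blast

text \<open>By \<open>star_add\<close>, a conjugate of a * b with a in \<open>I\<close> is again a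
  combination of such stars. A conjugate of b * a is a generator of the third kind, and those are
  closed under conjugation. Induction on generation extends this to the whole subgroup.\<close>

lemma normal_comm_Grp:
  assumes I: "I \<subseteq> carrier A"
  shows "normal (comm_Grp A I) (add_monoid A)"
proof -
  interpret N: subgroup "comm_Grp A I" "add_monoid A"
    by (rule subgroup_comm_Grp[OF I])
  have gens: "g \<oplus> x \<ominus> g \<in> comm_Grp A I" if x: "x \<in> comm_gens I" and g: "g \<in> carrier A" for x g
  proof -
    consider a b where "a \<in> I" "b \<in> carrier A" "x = star A a b"
      | a b where "a \<in> I" "b \<in> carrier A" "x = star A b a"
      | a b c where "a \<in> I" "b \<in> carrier A" "c \<in> carrier A" "x = c \<oplus> star A b a \<ominus> c"
      using x by blast
    then show ?thesis
    proof cases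
      case 1
      then have "g \<oplus> x \<ominus> g = \<ominus> star A a g \<oplus> star A a (g \<oplus> b)"
        using I g by (simp add: star_add add_cancel subset_iff)
      also have "\<dots> \<in> comm_Grp A I"
        using 1 g N.m_closed N.m_inv_closed star_comm_Grp1 by (simp flip: a_inv_def)
      finally show ?thesis .
    next
      case 2
      then show ?thesis using g star_comm_Grp3 by simp
    next
      case 3
      then have "g \<oplus> x \<ominus> g = (g \<oplus> c) \<oplus> star A b a \<ominus> (g \<oplus> c)"
        using I g by (simp add: a_minus_def add.m_assoc add.inv_mult_group subset_iff)
      then show ?thesis using 3 g star_comm_Grp3 by simp
    qed
  qed
  have conj: "g \<oplus> x \<ominus> g \<in> comm_Grp A I" if "x \<in> comm_Grp A I" and g: "g \<in> carrier A" for x g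
    using that(1) unfolding comm_Grp_def
  proof (induction rule: generate.induct)
    case one
    show ?case using g generate.one[of "add_monoid A"] by (simp add: a_minus_def)
  next
    case (incl x)
    show ?case using gens[OF incl g] by (simp only: comm_Grp_def)
  next
    case (inv x)
    have "x \<in> carrier A" using subsetD[OF comm_gens_subset[OF I] inv] .
    then have "g \<oplus> inv\<^bsub>add_monoid A\<^esub> x \<ominus> g = inv\<^bsub>add_monoid A\<^esub> (g \<oplus> x \<ominus> g)"
      using g by (simp add: add.inv_mult_group add.m_assoc a_minus_def flip: a_inv_def)
    then show ?case using N.m_inv_closed[OF gens[OF inv g]] by (simp only: comm_Grp_def)
  next
    case (eng x y)
    have "x \<in> carrier A" "y \<in> carrier A"
      using eng.hyps[THEN N.mem_carrier[unfolded comm_Grp_def]] by simp_all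
    then have "g \<oplus> (x \<oplus> y) \<ominus> g = (g \<oplus> x \<ominus> g) \<oplus> (g \<oplus> y \<ominus> g)"
      using g by (simp add: a_minus_def add.m_assoc add_cancel)
    then show ?case using N.m_closed[unfolded comm_Grp_def, OF eng.IH] by simp
  qed
  show ?thesis
    by (rule add.normal_invI[OF subgroup_comm_Grp[OF I]]) (use conj in \<open>simp add: a_minus_def\<close>)
qed

text \<open>The conjugate c + b * a - c equals - (b * c) + b * (c + a), so it stays in A * A. Facts
  on commutator ideals thereby apply to A * A.\<close>

lemma star_square_eq: "star_square A = comm_Grp A (carrier A)"
proof
  show "star_square A \<subseteq> comm_Grp A (carrier A)"
    unfolding star_square_def comm_Grp_def by (rule add.mono_generate) blast
  have sub: "subgroup (star_square A) (add_monoid A)"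
    unfolding star_square_def by (rule add.generate_is_subgroup) auto
  have star: "star A a b \<in> star_square A" if "a \<in> carrier A" "b \<in> carrier A" for a b
    unfolding star_square_def using that by (blast intro: generate.incl)
  have "c \<oplus> star A b a \<ominus> c \<in> star_square A"
    if "a \<in> carrier A" "b \<in> carrier A" "c \<in> carrier A" for a b c
  proof -
    have "c \<oplus> star A b a \<ominus> c = \<ominus> star A b c \<oplus> star A b (c \<oplus> a)"
      using that by (simp add: star_add add_cancel)
    also have "\<dots> \<in> star_square A"
      using subgroup.m_closed[OF sub subgroup.m_inv_closed[OF sub star] star] that
      by (simp flip: a_inv_def)
    finally show ?thesis .
  qed
  then show "comm_Grp A (carrier A) \<subseteq> star_square A"
    using star unfolding comm_Grp_def by (intro add.generate_subgroup_incl[OF _ sub]) auto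
qed

lemma normal_star_square: "normal (star_square A) (add_monoid A)"
  unfolding star_square_eq by (rule normal_comm_Grp) simp

lemma comm_Grp_mono: "I \<subseteq> J \<Longrightarrow> comm_Grp A I \<subseteq> comm_Grp A J"
  unfolding comm_Grp_def by (rule add.mono_generate) blast

lemma comm_Grp_subset_star_square: "I \<subseteq> carrier A \<Longrightarrow> comm_Grp A I \<subseteq> star_square A"
  unfolding star_square_eq by (rule comm_Grp_mono)

end

section \<open>Behaviour under homomorphisms\<close>

locale sb_morphism = A: sb A + B: sb B
  for A :: "('a, 'm) ring_scheme" and B :: "('b, 'n) ring_scheme" +
  fixes f :: "'a \<Rightarrow> 'b"
  assumes mor: "f \<in> sb_hom A B"
begin

lemma add_group_hom: "group_hom (add_monoid A) (add_monoid B) f"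
  using mor A.add.is_group B.add.is_group
  by (simp add: group_hom_def group_hom_axioms_def sb_hom_def)

lemma mul_group_hom: "group_hom A B f"
  using mor A.mul.is_group B.mul.is_group
  by (simp add: group_hom_def group_hom_axioms_def sb_hom_def)

lemma hom_closed [simp, intro]: "x \<in> carrier A \<Longrightarrow> f x \<in> carrier B"
  using group_hom.hom_closed[OF mul_group_hom] .

lemma hom_simps [simp]:
  "x \<in> carrier A \<Longrightarrow> y \<in> carrier A \<Longrightarrow> f (x \<oplus>\<^bsub>A\<^esub> y) = f x \<oplus>\<^bsub>B\<^esub> f y"
  "x \<in> carrier A \<Longrightarrow> y \<in> carrier A \<Longrightarrow> f (x \<otimes>\<^bsub>A\<^esub> y) = f x \<otimes>\<^bsub>B\<^esub> f y"
  "f \<zero>\<^bsub>A\<^esub> = \<zero>\<^bsub>B\<^esub>"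
  "x \<in> carrier A \<Longrightarrow> f (\<ominus>\<^bsub>A\<^esub> x) = \<ominus>\<^bsub>B\<^esub> f x"
  "x \<in> carrier A \<Longrightarrow> f (inv\<^bsub>A\<^esub> x) = inv\<^bsub>B\<^esub> f x"
  using group_hom.hom_mult[OF add_group_hom, of x y] group_hom.hom_mult[OF mul_group_hom, of x y]
    group_hom.hom_one[OF add_group_hom] group_hom.hom_inv[OF add_group_hom, of x]
    group_hom.hom_inv[OF mul_group_hom, of x]
  by (simp_all add: a_inv_def)

lemma hom_minus [simp]:
  "x \<in> carrier A \<Longrightarrow> y \<in> carrier A \<Longrightarrow> f (x \<ominus>\<^bsub>A\<^esub> y) = f x \<ominus>\<^bsub>B\<^esub> f y"
  by (simp add: a_minus_def)

lemma hom_star [simp]: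
  "x \<in> carrier A \<Longrightarrow> y \<in> carrier A \<Longrightarrow> f (star A x y) = star B (f x) (f y)"
  by (simp add: star_def)

lemma mem_kernel: "x \<in> sb_kernel A B f \<longleftrightarrow> x \<in> carrier A \<and> f x = \<zero>\<^bsub>B\<^esub>"
  by (simp add: sb_kernel_def kernel_def)

lemma sb_kernel_subset: "sb_kernel A B f \<subseteq> carrier A"
  by (auto simp: mem_kernel)

lemma star_square_image_subset: "f ` star_square A \<subseteq> star_square B"
proof -
  have "f ` star_square A =
      generate (add_monoid B) (f ` {star A a b | a b. a \<in> carrier A \<and> b \<in> carrier A})"
    unfolding star_square_def
    by (rule group_hom.generate_img[OF add_group_hom, symmetric]) auto
  also have "\<dots> \<subseteq> star_square B"
    unfolding star_square_def by (rule B.add.mono_generate) force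
  finally show ?thesis .
qed

text \<open>Surjectivity lifts the arguments that range over all of \<open>B\<close>, and the
  remaining one lifts inside \<open>I\<close>, so generators map onto generators. This transports
  commutator ideals along the counit, the faces and G f.\<close>

lemma comm_Grp_image:
  assumes surj: "f ` carrier A = carrier B" and I: "I \<subseteq> carrier A"
  shows "f ` comm_Grp A I = comm_Grp B (f ` I)"
proof -
  have "f ` A.comm_gens I = B.comm_gens (f ` I)" (is "?L = ?R")
  proof
    show "?L \<subseteq> ?R"
    proof (rule image_subsetI)
      fix x assume "x \<in> A.comm_gens I"
      then consider a b where "a \<in> I" "b \<in> carrier A" "x = star A a b"
        | a b where "a \<in> I" "b \<in> carrier A" "x = star A b a"
        | a b c where "a \<in> I" "b \<in> carrier A" "c \<in> carrier A" "x = c \<oplus>\<^bsub>A\<^esub> star A b a \<ominus>\<^bsub>A\<^esub> c"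
        by blast
      then show "f x \<in> ?R"
      proof cases
        case 1
        then have "f x = star B (f a) (f b)" using I by auto
        with 1 show ?thesis by blast
      next
        case 2
        then have "f x = star B (f b) (f a)" using I by auto
        with 2 show ?thesis by blast
      next
        case 3
        then have "f x = f c \<oplus>\<^bsub>B\<^esub> star B (f b) (f a) \<ominus>\<^bsub>B\<^esub> f c" using I by auto
        with 3 show ?thesis by blast
      qed
    qed
    show "?R \<subseteq> ?L"
    proof
      fix y assume "y \<in> ?R"
      then consider a b where "a \<in> f ` I" "b \<in> carrier B" "y = star B a b"
        | a b where "a \<in> f ` I" "b \<in> carrier B" "y = star B b a"
        | a b c where "a \<in> f ` I" "b \<in> carrier B" "c \<in> carrier B"
            "y = c \<oplus>\<^bsub>B\<^esub> star B b a \<ominus>\<^bsub>B\<^esub> c"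
        by blast
      then show "y \<in> ?L"
      proof cases
        case 1
        obtain a' where a': "a' \<in> I" "a = f a'" using 1(1) by (rule imageE)
        obtain b' where b': "b' \<in> carrier A" "b = f b'"
          using 1(2) unfolding surj[symmetric] by (rule imageE)
        have "y = f (star A a' b')"
          using 1(3) a' b'  I by (simp add: subset_iff)
        moreover have "star A a' b' \<in> A.comm_gens I" using a' b'  by blast
        ultimately show ?thesis by (rule image_eqI)
      next
        case 2
        obtain a' where a': "a' \<in> I" "a = f a'" using 2(1) by (rule imageE)
        obtain b' where b': "b' \<in> carrier A" "b = f b'"
          using 2(2) unfolding surj[symmetric] by (rule imageE)
        have "y = f (star A b' a')"
          using 2(3) a' b'  I by (simp add: subset_iff)
        moreover have "star A b' a' \<in> A.comm_gens I" using a' b'  by blast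
        ultimately show ?thesis by (rule image_eqI)
      next
        case 3
        obtain a' where a': "a' \<in> I" "a = f a'" using 3(1) by (rule imageE)
        obtain b' where b': "b' \<in> carrier A" "b = f b'"
          using 3(2) unfolding surj[symmetric] by (rule imageE)
        obtain c' where c': "c' \<in> carrier A" "c = f c'"
          using 3(3) unfolding surj[symmetric] by (rule imageE)
        have "y = f (c' \<oplus>\<^bsub>A\<^esub> star A b' a' \<ominus>\<^bsub>A\<^esub> c')"
          using 3(4) a' b' c' I by (simp add: subset_iff)
        moreover have "c' \<oplus>\<^bsub>A\<^esub> star A b' a' \<ominus>\<^bsub>A\<^esub> c' \<in> A.comm_gens I" using a' b' c' by blast
        ultimately show ?thesis by (rule image_eqI)
      qed
    qed
  qed
  moreover have "f ` generate (add_monoid A) (A.comm_gens I) =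
      generate (add_monoid B) (f ` A.comm_gens I)"
    using A.comm_gens_subset[OF I]
    by (intro group_hom.generate_img[OF add_group_hom, symmetric]) (simp only: partial_object.simps)
  ultimately show ?thesis
    unfolding comm_Grp_def by (simp only:)
qed

lemma star_square_image: "f ` carrier A = carrier B \<Longrightarrow> f ` star_square A = star_square B"
  by (simp add: A.star_square_eq B.star_square_eq comm_Grp_image)

text \<open>\<open>f\<close> sends each generator to a star with a zero argument or to a conjugate
  of one, and such a star vanishes because zero is neutral for both operations.\<close>

lemma comm_Grp_kernel_subset: "comm_Grp A (sb_kernel A B f) \<subseteq> sb_kernel A B f"
  unfolding comm_Grp_def
proof (rule A.add.generate_subgroup_incl)
  show "subgroup (sb_kernel A B f) (add_monoid A)"
    unfolding sb_kernel_def by (rule group_hom.subgroup_kernel[OF add_group_hom])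
  have "star B \<zero>\<^bsub>B\<^esub> y = \<zero>\<^bsub>B\<^esub>" "star B y \<zero>\<^bsub>B\<^esub> = \<zero>\<^bsub>B\<^esub>" if "y \<in> carrier B" for y
    using that by (simp_all add: star_def a_minus_def B.circ_zero B.zero_circ)
  then show "A.comm_gens (sb_kernel A B f) \<subseteq> sb_kernel A B f"
    by (auto simp: mem_kernel a_minus_def)
qed

text \<open>
  Writing \<open>r = s \<circ> f\<close>, decompose \<open>a = m \<circ> r a\<close> and \<open>b = r b + m'\<close> with \<open>m\<close> and \<open>m'\<close> in the
  kernel; then \<open>a * b\<close> and \<open>r a * r b\<close> agree modulo \<open>comm_Grp A (sb_kernel A B f)\<close>.
\<close>

lemma split_kernel_inter_star_square:
  assumes s: "s \<in> sb_hom B A" and fs: "\<And>y. y \<in> carrier B \<Longrightarrow> f (s y) = y"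
    and x: "x \<in> star_square A" "f x = \<zero>\<^bsub>B\<^esub>"
  shows "x \<in> comm_Grp A (sb_kernel A B f)"
proof -
  define N where "N = comm_Grp A (sb_kernel A B f)"
  interpret s: sb_morphism B A s
    using s by unfold_locales
  interpret N: normal N "add_monoid A"
    unfolding N_def by (rule A.normal_comm_Grp[OF sb_kernel_subset])
  define M where "M = add_monoid A Mod N"
  interpret \<pi>: group_hom "add_monoid A" M "\<lambda>x. N #>\<^bsub>add_monoid A\<^esub> x"
    unfolding M_def by (rule N.group_hom_coset)
  let ?\<pi> = "\<lambda>x. N #>\<^bsub>add_monoid A\<^esub> x" and ?r = "\<lambda>x. s (f x)"
  have \<pi>_add: "?\<pi> (x \<oplus>\<^bsub>A\<^esub> y) = ?\<pi> x \<otimes>\<^bsub>M\<^esub> ?\<pi> y"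
    if "x \<in> carrier A" "y \<in> carrier A" for x y
    using \<pi>.hom_mult that by simp
  have \<pi>_closed: "?\<pi> x \<in> carrier M" if "x \<in> carrier A" for x
    using \<pi>.hom_closed that by simp
  have \<pi>_N: "?\<pi> x = \<one>\<^bsub>M\<^esub>" if "x \<in> N" for x
    using N.coset_eq_one_iff that N.mem_carrier by (simp add: M_def)
  have star: "?\<pi> (star A a b) = ?\<pi> (star A (?r a) (?r b))"
    if ab: "a \<in> carrier A" "b \<in> carrier A" for a b
  proof -
    \<comment> \<open>The second argument is split additively, since \<open>star_add\<close> expands
      sums there. The conjugate term that appears belongs to the third family of generators.\<close>
    define m' where "m' = \<ominus>\<^bsub>A\<^esub> ?r b \<oplus>\<^bsub>A\<^esub> b"
    have m': "m' \<in> sb_kernel A B f" "m' \<in> carrier A"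
      using ab by (simp_all add: m'_def mem_kernel fs)
    have "b = ?r b \<oplus>\<^bsub>A\<^esub> m'"
      using ab by (simp add: m'_def A.add_cancel)
    then have "star A a b = star A a (?r b) \<oplus>\<^bsub>A\<^esub> (?r b \<oplus>\<^bsub>A\<^esub> star A a m' \<ominus>\<^bsub>A\<^esub> ?r b)"
      using A.star_add[of a "?r b" m'] ab m' by simp
    moreover have "?r b \<oplus>\<^bsub>A\<^esub> star A a m' \<ominus>\<^bsub>A\<^esub> ?r b \<in> N"
      unfolding N_def using ab m' by (intro A.star_comm_Grp3) auto
    ultimately have 1: "?\<pi> (star A a b) = ?\<pi> (star A a (?r b))"
      using ab m' by (simp add: \<pi>_add \<pi>_N \<pi>_closed)
    \<comment> \<open>The first argument is split with respect to \<circ>, as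
      \<open>star_circ\<close> requires. \<open>m\<close> is in the kernel because the two neutral
      elements of \<open>B\<close> agree.\<close>
    define m where "m = a \<otimes>\<^bsub>A\<^esub> inv\<^bsub>A\<^esub> ?r a"
    have m: "m \<in> sb_kernel A B f" "m \<in> carrier A"
      using ab by (simp_all add: m_def mem_kernel fs B.one_eq_zero)
    have "a = m \<otimes>\<^bsub>A\<^esub> ?r a"
      using ab by (simp add: m_def A.mul.m_assoc)
    then have "star A a (?r b) = star A m (star A (?r a) (?r b)) \<oplus>\<^bsub>A\<^esub>
        (star A (?r a) (?r b) \<oplus>\<^bsub>A\<^esub> star A m (?r b))"
      using A.star_circ[of m "?r b" "?r a"] ab m by simp
    moreover have "star A m (star A (?r a) (?r b)) \<in> N" "star A m (?r b) \<in> N"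
      unfolding N_def using ab m by (intro A.star_comm_Grp1; simp)+
    ultimately have "?\<pi> (star A a (?r b)) = ?\<pi> (star A (?r a) (?r b))"
      using ab m by (simp add: \<pi>_add \<pi>_N \<pi>_closed)
    with 1 show ?thesis by simp
  qed
  have sub: "x \<in> carrier A" if "x \<in> star_square A" for x
    using subgroup.mem_carrier[OF normal_imp_subgroup[OF A.normal_star_square] that] by simp
  \<comment> \<open>Both sides are additive homomorphisms to \<open>M\<close>, so agreement on stars
    extends to A * A. For the given \<open>x\<close> the right-hand side is trivial, since
    \<open>f x\<close> is zero.\<close>
  have "?\<pi> x = ?\<pi> (?r x)"
    using x(1) unfolding star_square_def
  proof (induction rule: generate.induct)
    case one
    show ?case by simp
  next
    case (incl x)
    then obtain a b where "a \<in> carrier A" "b \<in> carrier A" "x = star A a b" by blast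
    then show ?case using star[of a b] by simp
  next
    case (inv x)
    then obtain a b where ab: "a \<in> carrier A" "b \<in> carrier A" "x = star A a b" by blast
    then have "?\<pi> x = ?\<pi> (?r x)" using star[of a b] by simp
    then show ?case
      using \<pi>.hom_inv[of x] \<pi>.hom_inv[of "?r x"] ab by (simp flip: a_inv_def)
  next
    case (eng x y)
    have "x \<in> carrier A" "y \<in> carrier A"
      using eng.hyps[folded star_square_def, THEN sub] .
    then show ?case using eng.IH by (simp add: \<pi>_add)
  qed
  also have "\<dots> = ?\<pi> \<zero>\<^bsub>A\<^esub>"
    using x(2) by simp
  also have "\<dots> = \<one>\<^bsub>M\<^esub>"
    using \<pi>.hom_one by simp
  finally show ?thesis
    using N.coset_eq_one_iff sub[OF x(1)] by (simp add: N_def M_def)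
qed

end

section \<open>The free skew brace functor\<close>

lemma fsb_map_var [simp]: "fsb_map g (fsb_var x) = fsb_var (g x)"
  by transfer (simp add: sb_eq.refl)

lemma fsb_map_fsb_map: "fsb_map g (fsb_map h q) = fsb_map (g \<circ> h) q"
  by transfer (simp add: sb_term.map_comp sb_eq.refl)

lemma fsb_map_id: "fsb_map (\<lambda>x. x) q = q"
  by transfer (simp add: sb_term.map_ident sb_eq.refl)

text \<open>A representing term with variables in \<open>X\<close> sees only the values on
  \<open>X\<close>, so maps that agree merely on a carrier can be exchanged.\<close>

lemma fsb_map_cong:
  assumes "q \<in> carrier (free_sb X)" "\<And>x. x \<in> X \<Longrightarrow> g x = h x"
  shows "fsb_map g q = fsb_map h q"
proof -
  obtain t where t: "set_sb_term t \<subseteq> X" "q = abs_fsb t"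
    using assms(1) by (rule free_sb_cases)
  then have "map_sb_term g t = map_sb_term h t"
    using assms(2) by (intro sb_term.map_cong) auto
  then show ?thesis by (simp add: t fsb_map.abs_eq)
qed

lemma fsb_var_closed: "x \<in> X \<Longrightarrow> fsb_var x \<in> carrier (free_sb X)"
  by (simp add: fsb_var.abs_eq abs_fsb_mem)

lemma fsb_map_mor:
  assumes g: "g \<in> X \<rightarrow> Y"
  shows "fsb_map g \<in> sb_hom (free_sb X) (free_sb Y)"
proof -
  have closed: "fsb_map g q \<in> carrier (free_sb Y)" if q: "q \<in> carrier (free_sb X)" for q
  proof -
    obtain t where t: "set_sb_term t \<subseteq> X" "q = abs_fsb t"
      using q by (rule free_sb_cases)
    then show ?thesis
      using g by (auto simp: fsb_map.abs_eq sb_term.set_map Pi_iff subset_iff intro!: abs_fsb_mem)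
  qed
  have "fsb_map g (fsb_add p q) = fsb_add (fsb_map g p) (fsb_map g q)"
    "fsb_map g (fsb_circ p q) = fsb_circ (fsb_map g p) (fsb_map g q)" for p q
    by (transfer, simp add: sb_eq.refl)+
  then show ?thesis
    using closed by (simp add: sb_hom_def hom_def free_sb_simps)
qed

lemma fsb_map_surj:
  assumes g: "g ` X = Y"
  shows "fsb_map g ` carrier (free_sb X) = carrier (free_sb Y)"
proof
  show "fsb_map g ` carrier (free_sb X) \<subseteq> carrier (free_sb Y)"
    using fsb_map_mor[of g X Y] g by (auto simp: sb_hom_def hom_def)
  show "carrier (free_sb Y) \<subseteq> fsb_map g ` carrier (free_sb X)"
  proof
    fix q assume q: "q \<in> carrier (free_sb Y)"
    \<comment> \<open>A set-theoretic section of \<open>g\<close> induces a section of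
      \<open>fsb_map g\<close>.\<close>
    have "inv_into X g \<in> Y \<rightarrow> X"
      using g by (auto intro: inv_into_into)
    then have "fsb_map (inv_into X g) q \<in> carrier (free_sb X)"
      using fsb_map_mor q by (fastforce simp: sb_hom_def hom_def)
    moreover have "fsb_map g (fsb_map (inv_into X g) q) = fsb_map (\<lambda>x. x) q"
      unfolding fsb_map_fsb_map using g
      by (intro fsb_map_cong[OF q]) (auto simp: f_inv_into_f)
    ultimately show "q \<in> fsb_map g ` carrier (free_sb X)"
      by (metis fsb_map_id image_eqI)
  qed
qed

section \<open>Counit and comultiplication of the comonad\<close>

lemma sb_G_obj: "sb (G_obj A)"
  by unfold_locales (simp add: G_obj_def skew_brace_free_sb)

lemma (in sb) counit_abs:
  "set_sb_term t \<subseteq> carrier A \<Longrightarrow> counit A (abs_fsb t) = sb_eval A (\<lambda>b. b) t"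
  unfolding counit_def by (rule free_sb_ext_abs[OF skew_brace]) auto

lemma (in sb) counit_mor: "sb_morphism (G_obj A) A (counit A)"
proof -
  interpret G: sb "G_obj A" by (rule sb_G_obj)
  show ?thesis
    by unfold_locales
       (simp add: counit_def G_obj_def free_sb_ext_hom[OF skew_brace])
qed

lemma (in sb) counit_var: "x \<in> carrier A \<Longrightarrow> counit A (fsb_var x) = x"
  using counit_abs[of "Var x"] by (simp add: fsb_var.abs_eq)

lemma (in sb) counit_surj: "counit A ` carrier (G_obj A) = carrier A"
proof -
  interpret e: sb_morphism "G_obj A" A "counit A" by (rule counit_mor)
  have "x \<in> counit A ` carrier (G_obj A)" if "x \<in> carrier A" for x
    using that by (intro image_eqI[of _ _ "fsb_var x"])
      (simp_all add: counit_var fsb_var_closed G_obj_def)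
  then show ?thesis by auto
qed

text \<open>\<open>g\<close> is any map of carriers, such as \<open>fsb_var\<close> or a
  set-theoretic section of a surjection. Freeness turns it into a homomorphism.\<close>

lemma fsb_map_morI:
  assumes "g \<in> carrier A \<rightarrow> carrier B"
  shows "sb_morphism (G_obj A) (G_obj B) (fsb_map g)"
proof -
  interpret A: sb "G_obj A" by (rule sb_G_obj)
  interpret B: sb "G_obj B" by (rule sb_G_obj)
  show ?thesis
    by unfold_locales (simp add: G_obj_def fsb_map_mor[OF assms])
qed

lemma fsb_map_G_cong:
  "q \<in> carrier (G_obj A) \<Longrightarrow> (\<And>x. x \<in> carrier A \<Longrightarrow> g x = h x) \<Longrightarrow> fsb_map g q = fsb_map h q"
  unfolding G_obj_def by (rule fsb_map_cong)

lemma fsb_var_G [simp]: "x \<in> carrier A \<Longrightarrow> fsb_var x \<in> carrier (G_obj A)"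
  unfolding G_obj_def by (rule fsb_var_closed)

lemma (in sb_morphism) G_mor: "sb_morphism (G_obj A) (G_obj B) (fsb_map f)"
  by (rule fsb_map_morI) auto

lemma (in sb_morphism) G_surj:
  "f ` carrier A = carrier B \<Longrightarrow> fsb_map f ` carrier (G_obj A) = carrier (G_obj B)"
  unfolding G_obj_def by (rule fsb_map_surj)

text \<open>The counit evaluates a representing term, and a homomorphism commutes with evaluation.
  For the constant \<open>One\<close>, \<open>one_eq_zero\<close> turns both units into zeros, which
  \<open>f\<close> preserves.\<close>

lemma (in sb_morphism) counit_natural:
  assumes "q \<in> carrier (G_obj A)"
  shows "counit B (fsb_map f q) = f (counit A q)"
proof -
  obtain t where t: "set_sb_term t \<subseteq> carrier A" "q = abs_fsb t"
    using assms unfolding G_obj_def by (rule free_sb_cases)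
  have "set_sb_term (map_sb_term f t) \<subseteq> carrier B"
    using t by (auto simp: sb_term.set_map)
  then have "counit B (fsb_map f q) = sb_eval B (\<lambda>b. b) (map_sb_term f t)"
    by (simp add: t fsb_map.abs_eq B.counit_abs)
  also have "\<dots> = f (sb_eval A (\<lambda>a. a) t)"
    using t(1)
    by (induction t)
       (simp_all add: sb_eval_closed[OF A.skew_brace] Pi_iff subset_iff A.one_eq_zero B.one_eq_zero)
  also have "sb_eval A (\<lambda>a. a) t = counit A q"
    using t by (simp add: A.counit_abs)
  finally show ?thesis .
qed

context sb
begin

text \<open>\<open>fsb_map fsb_var\<close> is the comultiplication, G applied to the insertion of
  generators. It serves as the degeneracy s_0.\<close>

lemma comult_mor: "sb_morphism (G_obj A) (G_obj (G_obj A)) (fsb_map fsb_var)"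
  by (rule fsb_map_morI) simp

text \<open>First counit law, d_0 s_0 = id: evaluating \<open>t\<close> at the generators gives back
  the class of \<open>t\<close>.\<close>

lemma counit_comult:
  assumes "q \<in> carrier (G_obj A)"
  shows "counit (G_obj A) (fsb_map fsb_var q) = q"
proof -
  interpret G: sb "G_obj A" by (rule sb_G_obj)
  obtain t where t: "set_sb_term t \<subseteq> carrier A" "q = abs_fsb t"
    using assms unfolding G_obj_def by (rule free_sb_cases)
  have "set_sb_term (map_sb_term fsb_var t) \<subseteq> carrier (G_obj A)"
    using t by (auto simp: sb_term.set_map)
  then have "counit (G_obj A) (fsb_map fsb_var q) =
      sb_eval (G_obj A) (\<lambda>b. b) (map_sb_term fsb_var t)"
    by (simp add: t fsb_map.abs_eq G.counit_abs)
  also have "\<dots> = abs_fsb t"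
    using t(1)
    by (induction t)
       (simp_all add: free_sb_inverses abs_fsb_mem fsb_var.abs_eq fsb_zero.abs_eq fsb_one.abs_eq
         fsb_neg.abs_eq fsb_inv.abs_eq fsb_add.abs_eq fsb_circ.abs_eq
         G_obj_def free_sb_simps)
  finally show ?thesis by (simp add: t)
qed

text \<open>G applied to the first counit law; simplicially, d_1 s_1 = id.\<close>

lemma map_counit_map_comult:
  assumes "w \<in> carrier (G_obj (G_obj A))"
  shows "fsb_map (counit (G_obj A)) (fsb_map (fsb_map fsb_var) w) = w"
proof -
  have "fsb_map (counit (G_obj A)) (fsb_map (fsb_map fsb_var) w) = fsb_map (\<lambda>x. x) w"
    unfolding fsb_map_fsb_map by (rule fsb_map_G_cong[OF assms]) (simp add: counit_comult)
  then show ?thesis by (simp add: fsb_map_id)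
qed

text \<open>Second counit law, d_1 s_0 = id. Both maps are induced by maps of generators, where the
  law is \<open>counit_var\<close>.\<close>

lemma map_counit_comult:
  assumes "q \<in> carrier (G_obj A)"
  shows "fsb_map (counit A) (fsb_map fsb_var q) = q"
proof -
  have "fsb_map (counit A) (fsb_map fsb_var q) = fsb_map (\<lambda>x. x) q"
    unfolding fsb_map_fsb_map by (rule fsb_map_G_cong[OF assms]) (simp add: counit_var)
  then show ?thesis by (simp add: fsb_map_id)
qed

text \<open>With \<open>s\<^sub>0\<close> the comultiplication, \<open>s\<^sub>0 x - Var x + Var 0\<close> is the required element.\<close>

lemma counit_kernel_lift:
  assumes x: "x \<in> carrier (G_obj A)" "counit A x = \<zero>"
  obtains w where "w \<in> carrier (G_obj (G_obj A))"
    "counit (G_obj A) w = \<zero>\<^bsub>G_obj A\<^esub>" "fsb_map (counit A) w = x"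
proof -
  interpret G: sb "G_obj A" by (rule sb_G_obj)
  interpret GG: sb "G_obj (G_obj A)" by (rule sb_G_obj)
  interpret e: sb_morphism "G_obj A" A "counit A" by (rule counit_mor)
  interpret d0: sb_morphism "G_obj (G_obj A)" "G_obj A" "counit (G_obj A)" by (rule G.counit_mor)
  interpret d1: sb_morphism "G_obj (G_obj A)" "G_obj A" "fsb_map (counit A)" by (rule e.G_mor)
  interpret s0: sb_morphism "G_obj A" "G_obj (G_obj A)" "fsb_map fsb_var" by (rule comult_mor)
  \<comment> \<open>The counit gives x - x + 0 = 0. The other face gives x - Var 0 + Var 0 = x,
    since the counit kills \<open>x\<close>.\<close>
  show ?thesis
    by (rule that[of "(fsb_map fsb_var x \<ominus>\<^bsub>G_obj (G_obj A)\<^esub> fsb_var x)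
          \<oplus>\<^bsub>G_obj (G_obj A)\<^esub> fsb_var \<zero>\<^bsub>G_obj A\<^esub>"])
       (use x in \<open>simp_all add: counit_comult map_counit_comult G.counit_var a_minus_def G.add.m_assoc\<close>)
qed

text \<open>
  The element \<open>Var w - Var 0\<close> has faces \<open>(w, 0, 0)\<close>; the degeneracies of \<open>w\<close> have faces
  \<open>(w, w, 0)\<close> and \<open>(0, w, w)\<close>.
\<close>

lemma counit_kernel_lift2:
  assumes w: "w \<in> carrier (G_obj (G_obj A))" "counit (G_obj A) w = \<zero>\<^bsub>G_obj A\<^esub>"
    "fsb_map (counit A) w = \<zero>\<^bsub>G_obj A\<^esub>"
  obtains v where "v \<in> carrier (G_obj (G_obj (G_obj A)))"
    "counit (G_obj (G_obj A)) v = \<zero>\<^bsub>G_obj (G_obj A)\<^esub>"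
    "fsb_map (counit (G_obj A)) v = \<zero>\<^bsub>G_obj (G_obj A)\<^esub>"
    "fsb_map (fsb_map (counit A)) v = w"
proof -
  let ?G = "G_obj A" and ?GG = "G_obj (G_obj A)" and ?GGG = "G_obj (G_obj (G_obj A))"
  interpret G: sb ?G by (rule sb_G_obj)
  interpret GG: sb ?GG by (rule sb_G_obj)
  interpret GGG: sb ?GGG by (rule sb_G_obj)
  interpret e: sb_morphism ?G A "counit A" by (rule counit_mor)
  interpret e1: sb_morphism ?GG ?G "counit ?G" by (rule G.counit_mor)
  interpret Ge: sb_morphism ?GG ?G "fsb_map (counit A)" by (rule e.G_mor)
  interpret d0: sb_morphism ?GGG ?GG "counit ?GG" by (rule GG.counit_mor)
  interpret d1: sb_morphism ?GGG ?GG "fsb_map (counit ?G)" by (rule e1.G_mor)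
  interpret d2: sb_morphism ?GGG ?GG "fsb_map (fsb_map (counit A))" by (rule Ge.G_mor)
  interpret c: sb_morphism ?G ?GG "fsb_map fsb_var" by (rule comult_mor)
  interpret s0: sb_morphism ?GG ?GGG "fsb_map fsb_var" by (rule G.comult_mor)
  interpret s1: sb_morphism ?GG ?GGG "fsb_map (fsb_map fsb_var)" by (rule c.G_mor)
  \<comment> \<open>Two simplicial identities follow from naturality: d_2 s_0 = s_0 d_1 from that of
    \<open>fsb_var\<close>, and d_0 s_1 = s_0 d_0 from that of the counit.\<close>
  have d2s0: "fsb_map (fsb_map (counit A)) (fsb_map fsb_var w) = \<zero>\<^bsub>?GG\<^esub>"
  proof -
    have "fsb_map (fsb_map (counit A)) (fsb_map fsb_var w) = fsb_map fsb_var (fsb_map (counit A) w)"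
      unfolding fsb_map_fsb_map by (rule arg_cong[of _ _ "\<lambda>g. fsb_map g w"]) auto
    then show ?thesis using w by simp
  qed
  have d0s1: "counit ?GG (fsb_map (fsb_map fsb_var) w) = \<zero>\<^bsub>?GG\<^esub>"
    using c.counit_natural w by simp
  have d2s1: "fsb_map (fsb_map (counit A)) (fsb_map (fsb_map fsb_var) w) = w"
  proof -
    have "fsb_map (fsb_map (counit A)) (fsb_map (fsb_map fsb_var) w) = fsb_map (\<lambda>x. x) w"
      unfolding fsb_map_fsb_map[of "fsb_map (counit A)"]
      by (rule fsb_map_G_cong[OF w(1)]) (simp add: map_counit_comult)
    then show ?thesis by (simp add: fsb_map_id)
  qed
  \<comment> \<open>Subtracting the first degeneracy and adding the second turns the faces into (w -
    w + 0, 0 - w + w, 0 - 0 + w) = (0, 0, w).\<close>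
  show ?thesis
    by (rule that[of "((fsb_var w \<ominus>\<^bsub>?GGG\<^esub> fsb_var \<zero>\<^bsub>?GG\<^esub>) \<ominus>\<^bsub>?GGG\<^esub> fsb_map fsb_var w)
          \<oplus>\<^bsub>?GGG\<^esub> fsb_map (fsb_map fsb_var) w"])
       (use w in \<open>simp_all add: d2s0 d0s1 map_counit_map_comult d2s1 G.counit_comult G.map_counit_comult
          GG.counit_var a_minus_def GG.add.m_assoc\<close>)
qed

end

section \<open>Classes in the reflection\<close>

definition refl_class :: "('a, 'm) ring_scheme \<Rightarrow> 'a \<Rightarrow> 'a set" where
  "refl_class A x = star_square A #>\<^bsub>add_monoid A\<^esub> x"

context sb
begin

lemma subgroup_star_square: "subgroup (star_square A) (add_monoid A)"
  by (rule normal_imp_subgroup[OF normal_star_square])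

lemma group_hom_refl_class: "group_hom (add_monoid A) (refl_obj A) (refl_class A)"
  unfolding refl_obj_def refl_class_def by (rule normal.group_hom_coset[OF normal_star_square])

lemma refl_class_surj: "refl_class A ` carrier A = carrier (refl_obj A)"
  using normal.coset_surj[OF normal_star_square] by (simp add: refl_obj_def refl_class_def)

lemma refl_class_eq_one_iff:
  "x \<in> carrier A \<Longrightarrow> refl_class A x = \<one>\<^bsub>refl_obj A\<^esub> \<longleftrightarrow> x \<in> star_square A"
  unfolding refl_obj_def refl_class_def
  by (rule normal.coset_eq_one_iff[OF normal_star_square]) simp

lemma group_refl_obj: "group (refl_obj A)"
  using group_hom_refl_class by (simp add: group_hom_def)

lemma refl_class_minus:
  assumes "x \<in> carrier A" "y \<in> carrier A"
  shows "refl_class A (x \<ominus> y) = refl_class A x \<otimes>\<^bsub>refl_obj A\<^esub> inv\<^bsub>refl_obj A\<^esub> refl_class A y"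
  using assms group_hom.hom_mult[OF group_hom_refl_class, of x "\<ominus> y"]
    group_hom.hom_inv[OF group_hom_refl_class, of y]
  by (simp add: a_minus_def flip: a_inv_def)

lemma refl_class_closed: "x \<in> carrier A \<Longrightarrow> refl_class A x \<in> carrier (refl_obj A)"
  using refl_class_surj by blast

lemma refl_class_eq_iff:
  assumes "x \<in> carrier A" "y \<in> carrier A"
  shows "refl_class A x = refl_class A y \<longleftrightarrow> x \<ominus> y \<in> star_square A"
proof -
  interpret F: group "refl_obj A" by (rule group_refl_obj)
  have "x \<ominus> y \<in> star_square A \<longleftrightarrow> refl_class A x \<otimes>\<^bsub>refl_obj A\<^esub> inv\<^bsub>refl_obj A\<^esub> refl_class A y = \<one>\<^bsub>refl_obj A\<^esub>"
    using assms refl_class_eq_one_iff[of "x \<ominus> y"] by (simp add: refl_class_minus)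
  also have "\<dots> \<longleftrightarrow> refl_class A x = refl_class A y"
    using assms refl_class_closed by (simp add: F.mult_inv_eq_one_iff)
  finally show ?thesis by simp
qed

end

context sb_morphism
begin

lemma refl_map_class: "x \<in> carrier A \<Longrightarrow> refl_map B f (refl_class A x) = refl_class B (f x)"
  unfolding refl_map_def refl_class_def
  by (rule group_hom.quot_map_coset[OF add_group_hom A.subgroup_star_square B.subgroup_star_square
        star_square_image_subset]) simp

lemma group_hom_refl_map: "group_hom (refl_obj A) (refl_obj B) (refl_map B f)"
proof (rule group_hom_via_epi[OF A.group_refl_obj B.group_refl_obj A.group_hom_refl_class])
  show "refl_class A ` carrier (add_monoid A) = carrier (refl_obj A)"
    using A.refl_class_surj by simp
  show "group_hom (add_monoid A) (refl_obj B) (\<lambda>x. refl_class B (f x))"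
    by (rule group_hom_comp[OF add_group_hom B.group_hom_refl_class])
qed (simp add: refl_map_class)

text \<open>If f x lies in B * B, which is the image of A * A, then x = u + y with u in A * A and f
  y = 0. A kernel condition in the reflection can thus be made exact on a representative.\<close>

lemma kernel_refl_map:
  assumes surj: "f ` carrier A = carrier B"
  shows "kernel (refl_obj A) (refl_obj B) (refl_map B f) = refl_class A ` sb_kernel A B f"
proof
  show "kernel (refl_obj A) (refl_obj B) (refl_map B f) \<subseteq> refl_class A ` sb_kernel A B f"
  proof
    fix z assume "z \<in> kernel (refl_obj A) (refl_obj B) (refl_map B f)"
    then have z: "z \<in> carrier (refl_obj A)" "refl_map B f z = \<one>\<^bsub>refl_obj B\<^esub>"
      by (simp_all add: kernel_def)
    then obtain x where x: "x \<in> carrier A" "z = refl_class A x"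
      using A.refl_class_surj by blast
    then have "f x \<in> star_square B"
      using z B.refl_class_eq_one_iff by (simp add: refl_map_class)
    then have "f x \<in> f ` star_square A"
      by (simp only: star_square_image[OF surj])
    then obtain u where u: "f x = f u" "u \<in> star_square A"
      by (rule imageE)
    then have uA: "u \<in> carrier A"
      using subgroup.mem_carrier[OF A.subgroup_star_square] by simp
    define y where "y = \<ominus>\<^bsub>A\<^esub> u \<oplus>\<^bsub>A\<^esub> x"
    have y: "y \<in> carrier A" "x = u \<oplus>\<^bsub>A\<^esub> y"
      using x uA by (simp_all add: y_def A.add_cancel)
    have "y \<in> sb_kernel A B f"
      using x uA u by (simp add: y_def mem_kernel)
    moreover have "z = refl_class A y"
    proof -
      interpret F: group_hom "add_monoid A" "refl_obj A" "refl_class A"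
        by (rule A.group_hom_refl_class)
      have "refl_class A x = refl_class A u \<otimes>\<^bsub>refl_obj A\<^esub> refl_class A y"
        using F.hom_mult[of u y] y uA by simp
      then show ?thesis
        using A.refl_class_eq_one_iff[OF uA] u x y A.refl_class_closed by simp
    qed
    ultimately show "z \<in> refl_class A ` sb_kernel A B f" by blast
  qed
  show "refl_class A ` sb_kernel A B f \<subseteq> kernel (refl_obj A) (refl_obj B) (refl_map B f)"
    using A.refl_class_closed group_hom.hom_one[OF B.group_hom_refl_class]
    by (auto simp: mem_kernel kernel_def refl_map_class)
qed

end

section \<open>The Hopf formula\<close>

text \<open>The augmentation and the faces in degrees 1 and 2. Through the prefixes,
  \<open>e.B\<close>, \<open>e.A\<close>, \<open>d0.A\<close> and \<open>f0.A\<close> give the skew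
  brace facts for A, G A, G (G A) and G (G (G A)).\<close>

locale resolution =
  e: sb_morphism "G_obj A" A "counit A" +
  d0: sb_morphism "G_obj (G_obj A)" "G_obj A" "counit (G_obj A)" +
  d1: sb_morphism "G_obj (G_obj A)" "G_obj A" "fsb_map (counit A)" +
  f0: sb_morphism "G_obj (G_obj (G_obj A))" "G_obj (G_obj A)" "counit (G_obj (G_obj A))" +
  f1: sb_morphism "G_obj (G_obj (G_obj A))" "G_obj (G_obj A)" "fsb_map (counit (G_obj A))" +
  f2: sb_morphism "G_obj (G_obj (G_obj A))" "G_obj (G_obj A)" "fsb_map (fsb_map (counit A))"
  for A :: "('a, 'm) ring_scheme"

lemma (in sb) resolution: "resolution A"
proof -
  interpret G: sb "G_obj A" by (rule sb_G_obj)
  interpret GG: sb "G_obj (G_obj A)" by (rule sb_G_obj)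
  interpret e: sb_morphism "G_obj A" A "counit A" by (rule counit_mor)
  interpret d0: sb_morphism "G_obj (G_obj A)" "G_obj A" "counit (G_obj A)" by (rule G.counit_mor)
  interpret d1: sb_morphism "G_obj (G_obj A)" "G_obj A" "fsb_map (counit A)" by (rule e.G_mor)
  show ?thesis
    by (intro resolution.intro counit_mor G.counit_mor GG.counit_mor e.G_mor d0.G_mor d1.G_mor)
qed

context resolution
begin

section \<open>Faces in low degrees and their kernels\<close>

abbreviation "P \<equiv> G_obj A"
abbreviation "Q \<equiv> G_obj (G_obj A)"
abbreviation "R \<equiv> G_obj (G_obj (G_obj A))"
abbreviation "L \<equiv> sb_kernel P A (counit A)"
abbreviation "M \<equiv> sb_kernel Q P (counit P)"
abbreviation "D \<equiv> fsb_map (counit A)"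

lemma surjs:
  "counit A ` carrier P = carrier A" "counit P ` carrier Q = carrier P"
  "counit Q ` carrier R = carrier Q" "D ` carrier Q = carrier P"
  "fsb_map (counit P) ` carrier R = carrier Q"
  using e.B.counit_surj e.A.counit_surj d0.A.counit_surj
  by (simp_all add: e.G_surj d0.G_surj)

text \<open>The simplicial identities d_i d_j = d_(j-1) d_i for i < j, including the augmentation.
  Those with i = 0 and the augmented one are naturality of the counit; the last is G applied to the
  first.\<close>

lemma faces:
  "w \<in> carrier Q \<Longrightarrow> counit A (D w) = counit A (counit P w)"
  "v \<in> carrier R \<Longrightarrow> counit P (fsb_map D v) = D (counit Q v)"
  "v \<in> carrier R \<Longrightarrow> counit P (fsb_map (counit P) v) = counit P (counit Q v)"
  "v \<in> carrier R \<Longrightarrow> D (fsb_map D v) = D (fsb_map (counit P) v)"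
  using e.counit_natural d1.counit_natural d0.counit_natural
  by (simp_all add: fsb_map_fsb_map cong: fsb_map_G_cong)

text \<open>Preimages come from \<open>counit_kernel_lift\<close>; this makes the resolution exact
  in degree 0 before reflection.\<close>

lemma image_M: "D ` M = L"
proof
  show "D ` M \<subseteq> L"
    by (auto simp: d0.mem_kernel e.mem_kernel faces)
  show "L \<subseteq> D ` M"
  proof
    fix x assume "x \<in> L"
    then have "x \<in> carrier P" "counit A x = \<zero>\<^bsub>A\<^esub>"
      by (simp_all add: e.mem_kernel)
    then obtain w where "w \<in> carrier Q" "counit P w = \<zero>\<^bsub>P\<^esub>" "D w = x"
      by (rule e.B.counit_kernel_lift)
    then show "x \<in> D ` M" by (auto simp: d0.mem_kernel)
  qed
qed

text \<open>The degeneracy s_1 w is a preimage of w: d_1 s_1 w = w, and d_0 s_1 w = s_0 d_0 w =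
  0.\<close>

lemma image_kernel_f0: "fsb_map (counit P) ` sb_kernel R Q (counit Q) = M"
proof
  show "fsb_map (counit P) ` sb_kernel R Q (counit Q) \<subseteq> M"
    by (auto simp: d0.mem_kernel f0.mem_kernel faces)
  interpret c: sb_morphism P Q "fsb_map fsb_var" by (rule e.B.comult_mor)
  interpret s1: sb_morphism Q R "fsb_map (fsb_map fsb_var)" by (rule c.G_mor)
  show "M \<subseteq> fsb_map (counit P) ` sb_kernel R Q (counit Q)"
  proof
    fix w assume "w \<in> M"
    then have w: "w \<in> carrier Q" "counit P w = \<zero>\<^bsub>P\<^esub>"
      by (simp_all add: d0.mem_kernel)
    then have "fsb_map (fsb_map fsb_var) w \<in> sb_kernel R Q (counit Q)"
      using c.counit_natural[OF w(1)] by (simp add: f0.mem_kernel)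
    then show "w \<in> fsb_map (counit P) ` sb_kernel R Q (counit Q)"
      by (rule image_eqI[of _ "fsb_map (counit P)", OF e.B.map_counit_map_comult[OF w(1), symmetric]])
  qed
qed

text \<open>The comultiplication is a section of d_0, so the result on split epimorphisms
  applies.\<close>

lemma M_inter_star_square:
  assumes "w \<in> star_square Q" "counit P w = \<zero>\<^bsub>P\<^esub>"
  shows "w \<in> comm_Grp Q M"
  using sb_morphism.mor[OF e.B.comult_mor] e.B.counit_comult assms
  by (rule d0.split_kernel_inter_star_square)

section \<open>Cycles and boundaries on representatives\<close>

lemma N1_eq: "N1 A = refl_class Q ` M"
  unfolding N1_def X1_def X0_def face10_def by (rule d0.kernel_refl_map[OF surjs(2)])

lemma boundaries0_eq: "boundaries0 A = refl_class P ` L"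
proof -
  have "face11 A (refl_class Q w) = refl_class P (D w)" if "w \<in> M" for w
    using that by (simp add: face11_def d1.refl_map_class d0.mem_kernel)
  then have "boundaries0 A = (\<lambda>w. refl_class P (D w)) ` M"
    unfolding boundaries0_def N1_eq image_image by (rule image_cong[OF HOL.refl])
  then show ?thesis
    by (simp add: image_image flip: image_M)
qed

text \<open>By \<open>kernel_refl_map\<close>, d_0 w can be normalised to zero exactly, whereas
  triviality of the class of d_1 w only puts d_1 w into P * P.\<close>

definition cycle_reps where
  "cycle_reps = {w \<in> carrier Q. counit P w = \<zero>\<^bsub>P\<^esub> \<and> D w \<in> star_square P}"

text \<open>These are the last faces of the elements of \<open>R\<close> whose other two faces
  vanish, by \<open>faces\<close> and \<open>counit_kernel_lift2\<close>.\<close>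

definition boundary_reps where
  "boundary_reps = {w \<in> carrier Q. counit P w = \<zero>\<^bsub>P\<^esub> \<and> D w = \<zero>\<^bsub>P\<^esub>}"

lemma cycles1_eq: "cycles1 A = refl_class Q ` cycle_reps"
proof -
  have "cycles1 A = {z \<in> refl_class Q ` M. face11 A z = \<one>\<^bsub>refl_obj P\<^esub>}"
    by (simp add: cycles1_def kernel_def N1_eq X0_def)
  also have "\<dots> = refl_class Q ` {w \<in> M. face11 A (refl_class Q w) = \<one>\<^bsub>refl_obj P\<^esub>}"
    by blast
  also have "{w \<in> M. face11 A (refl_class Q w) = \<one>\<^bsub>refl_obj P\<^esub>} = cycle_reps"
    unfolding cycle_reps_def
    by (rule Collect_cong)
       (simp add: face11_def d1.refl_map_class d0.mem_kernel e.A.refl_class_eq_one_iff cong: conj_cong)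
  finally show ?thesis .
qed

text \<open>A class in \<open>N2 A\<close> has a representative v with d_0 v = 0 and d_1 v in M
  \<inter> Q * Q = [M, Q]. The latter is the image under d_1 of [Ker d_0, R], so v can be corrected
  until both faces vanish. The converse is \<open>counit_kernel_lift2\<close>.\<close>

lemma boundaries1_eq: "boundaries1 A = refl_class Q ` boundary_reps"
proof
  show "boundaries1 A \<subseteq> refl_class Q ` boundary_reps"
  proof
    fix z assume "z \<in> boundaries1 A"
    then obtain y where y: "y \<in> N2 A" "z = face22 A y"
      by (auto simp: boundaries1_def)
    have "y \<in> refl_class R ` sb_kernel R Q (counit Q)"
      using y(1) f0.kernel_refl_map[OF surjs(3)]
      by (simp add: N2_def X2_def X1_def face20_def)
    then obtain v where v: "v \<in> carrier R" "counit Q v = \<zero>\<^bsub>Q\<^esub>" "y = refl_class R v"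
      by (auto simp: f0.mem_kernel)
    have "refl_class Q (fsb_map (counit P) v) = \<one>\<^bsub>refl_obj Q\<^esub>"
      using y(1) v by (simp add: N2_def X1_def face21_def kernel_def f1.refl_map_class)
    then have "fsb_map (counit P) v \<in> star_square Q"
      using v by (simp add: d0.A.refl_class_eq_one_iff)
    moreover have "counit P (fsb_map (counit P) v) = \<zero>\<^bsub>P\<^esub>"
      using v by (simp add: faces)
    ultimately have "fsb_map (counit P) v \<in> comm_Grp Q M"
      by (rule M_inter_star_square)
    also have "comm_Grp Q M = fsb_map (counit P) ` comm_Grp R (sb_kernel R Q (counit Q))"
      using f1.comm_Grp_image[OF surjs(5) f0.sb_kernel_subset] by (simp add: image_kernel_f0)
    finally obtain n where n: "fsb_map (counit P) v = fsb_map (counit P) n"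
        "n \<in> comm_Grp R (sb_kernel R Q (counit Q))"
      by (rule imageE)
    have n': "n \<in> carrier R" "counit Q n = \<zero>\<^bsub>Q\<^esub>"
      using subsetD[OF f0.comm_Grp_kernel_subset n(2)] by (simp_all add: f0.mem_kernel)
    have nn: "n \<in> star_square R"
      using subsetD[OF f0.A.comm_Grp_subset_star_square[OF f0.sb_kernel_subset] n(2)] .
    \<comment> \<open>Subtracting \<open>n\<close> makes the first two faces vanish exactly. The
      class is unchanged because \<open>n\<close> lies in R * R.\<close>
    define u where "u = v \<oplus>\<^bsub>R\<^esub> (\<ominus>\<^bsub>R\<^esub> n)"
    have u: "u \<in> carrier R" "counit Q u = \<zero>\<^bsub>Q\<^esub>" "fsb_map (counit P) u = \<zero>\<^bsub>Q\<^esub>"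
      using v n n' by (simp_all add: u_def)
    have "refl_class R u = refl_class R v"
    proof -
      interpret F: group_hom "add_monoid R" "refl_obj R" "refl_class R"
        by (rule f0.A.group_hom_refl_class)
      have "refl_class R n = \<one>\<^bsub>refl_obj R\<^esub>"
        using f0.A.refl_class_eq_one_iff n' nn by simp
      moreover have "v = u \<oplus>\<^bsub>R\<^esub> n"
        using v n' by (simp add: u_def f0.A.add.m_assoc)
      ultimately show ?thesis
        using F.hom_mult[of u n] u n' f0.A.refl_class_closed by simp
    qed
    then have "z = refl_class Q (fsb_map D u)"
      using y v u by (simp add: face22_def f2.refl_map_class flip: \<open>refl_class R u = refl_class R v\<close>)
    moreover have "fsb_map D u \<in> boundary_reps"
      using u by (simp add: boundary_reps_def faces)
    ultimately show "z \<in> refl_class Q ` boundary_reps" by blast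
  qed
  show "refl_class Q ` boundary_reps \<subseteq> boundaries1 A"
  proof (rule image_subsetI)
    fix w assume "w \<in> boundary_reps"
    then have "w \<in> carrier Q" "counit P w = \<zero>\<^bsub>P\<^esub>" "D w = \<zero>\<^bsub>P\<^esub>"
      by (simp_all add: boundary_reps_def)
    then obtain v where v: "v \<in> carrier R" "counit Q v = \<zero>\<^bsub>Q\<^esub>" "fsb_map (counit P) v = \<zero>\<^bsub>Q\<^esub>"
        "fsb_map D v = w"
      by (rule e.B.counit_kernel_lift2)
    have "refl_class R v \<in> N2 A"
      using v f0.A.refl_class_closed group_hom.hom_one[OF d0.A.group_hom_refl_class]
      by (simp add: N2_def X2_def X1_def face20_def face21_def kernel_def
          f0.refl_map_class f1.refl_map_class)
    moreover have "face22 A (refl_class R v) = refl_class Q w"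
      using v by (simp add: face22_def f2.refl_map_class)
    ultimately show "refl_class Q w \<in> boundaries1 A"
      unfolding boundaries1_def by (rule rev_image_eqI[OF _ HOL.sym])
  qed
qed

lemma normal_boundaries0: "normal (boundaries0 A) (X0 A)"
  unfolding boundaries0_eq X0_def
proof (rule group_hom.normal_image[OF e.A.group_hom_refl_class])
  show "normal L (add_monoid P)"
    unfolding sb_kernel_def by (rule group_hom.normal_kernel[OF e.add_group_hom])
qed (simp add: e.A.refl_class_surj)

lemma normal_boundary_reps: "normal boundary_reps (add_monoid Q)"
proof -
  have eq: "boundary_reps = kernel (add_monoid Q) (add_monoid P) (counit P) \<inter>
      kernel (add_monoid Q) (add_monoid P) D"
    by (auto simp: boundary_reps_def kernel_def)
  show ?thesis
    unfolding eq
    by (intro d0.A.add.normal_subgroup_intersect group_hom.normal_kernel d0.add_group_hom d1.add_group_hom)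
qed

lemma normal_boundaries1: "normal (boundaries1 A) (X1 A)"
  unfolding boundaries1_eq X1_def
  by (rule group_hom.normal_image[OF d0.A.group_hom_refl_class _ normal_boundary_reps])
     (simp add: d0.A.refl_class_surj)

lemma subgroup_cycle_reps: "subgroup cycle_reps (add_monoid Q)"
proof -
  interpret S: subgroup "star_square P" "add_monoid P" by (rule e.A.subgroup_star_square)
  have S_add: "x \<oplus>\<^bsub>P\<^esub> y \<in> star_square P" if "x \<in> star_square P" "y \<in> star_square P" for x y
    using S.m_closed[OF that] by simp
  have S_neg: "\<ominus>\<^bsub>P\<^esub> x \<in> star_square P" if "x \<in> star_square P" for x
    using S.m_inv_closed[OF that] by (simp add: a_inv_def)
  show ?thesis
  proof (rule d0.A.add.subgroupI)
    show "cycle_reps \<subseteq> carrier Q" by (auto simp: cycle_reps_def)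
    have "\<zero>\<^bsub>Q\<^esub> \<in> cycle_reps"
      using S.one_closed by (simp add: cycle_reps_def)
    then show "cycle_reps \<noteq> {}" by blast
    show "\<ominus>\<^bsub>Q\<^esub> x \<in> cycle_reps" if "x \<in> cycle_reps" for x
      using that S_neg by (simp add: cycle_reps_def)
    show "x \<oplus>\<^bsub>Q\<^esub> y \<in> cycle_reps" if "x \<in> cycle_reps" "y \<in> cycle_reps" for x y
      using that S_add by (simp add: cycle_reps_def)
  qed
qed

lemma subgroup_cycles1: "subgroup (cycles1 A) (X1 A)"
  unfolding cycles1_eq X1_def
  by (rule group_hom.subgroup_img_is_subgroup[OF d0.A.group_hom_refl_class subgroup_cycle_reps])

lemma boundary_reps_subset: "boundary_reps \<subseteq> cycle_reps"
  using subgroup.one_closed[OF e.A.subgroup_star_square]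
  by (auto simp: boundary_reps_def cycle_reps_def)

lemma normal_boundaries1_cycles1: "normal (boundaries1 A) ((X1 A)\<lparr>carrier := cycles1 A\<rparr>)"
proof (rule group.normal_restrict_supergroup[OF _ subgroup_cycles1 normal_boundaries1])
  show "group (X1 A)" unfolding X1_def by (rule d0.A.group_refl_obj)
  show "boundaries1 A \<subseteq> cycles1 A"
    unfolding boundaries1_eq cycles1_eq using boundary_reps_subset by (rule image_mono)
qed

section \<open>Classes in the first homology group\<close>

lemma group_hom_H1_class: "group_hom (add_monoid P) (H1 A) (H1_class A)"
proof -
  have "group_hom (add_monoid P) (H1 A) (\<lambda>x. boundaries0 A #>\<^bsub>X0 A\<^esub> refl_class P x)"
    unfolding H1_def
    using e.A.group_hom_refl_class normal.group_hom_coset[OF normal_boundaries0]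
    unfolding X0_def by (rule group_hom_comp)
  moreover have "H1_class A = (\<lambda>x. boundaries0 A #>\<^bsub>X0 A\<^esub> refl_class P x)"
    by (rule ext) (simp add: H1_class_def refl_class_def)
  ultimately show ?thesis by (simp only:)
qed

lemma H1_class_surj: "H1_class A ` carrier P = carrier (H1 A)"
  unfolding H1_def normal.coset_surj[OF normal_boundaries0, symmetric]
  unfolding X0_def e.A.refl_class_surj[symmetric]
  by (simp add: H1_class_def image_image X0_def refl_class_def)

text \<open>The class of x is trivial iff x differs from an element of L by one of P * P. Since the
  counit has kernel L and maps P * P onto A * A, this is a condition on its value at x
  alone.\<close>

lemma H1_class_eq_one_iff:
  assumes x: "x \<in> carrier P"
  shows "H1_class A x = \<one>\<^bsub>H1 A\<^esub> \<longleftrightarrow> counit A x \<in> star_square A"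
proof -
  have "H1_class A x = \<one>\<^bsub>H1 A\<^esub> \<longleftrightarrow> refl_class P x \<in> boundaries0 A"
    using x normal.coset_eq_one_iff[OF normal_boundaries0, of "refl_class P x"] e.A.refl_class_closed
    by (simp add: H1_class_def refl_class_def H1_def X0_def)
  also have "\<dots> \<longleftrightarrow> counit A x \<in> star_square A"
  proof
    assume "refl_class P x \<in> boundaries0 A"
    then obtain l where l: "l \<in> L" "refl_class P x = refl_class P l"
      unfolding boundaries0_eq by (rule imageE)
    then have l': "l \<in> carrier P" "counit A l = \<zero>\<^bsub>A\<^esub>"
      by (simp_all add: e.mem_kernel)
    have "x \<ominus>\<^bsub>P\<^esub> l \<in> star_square P"
      using l l' x e.A.refl_class_eq_iff by simp
    then have "counit A (x \<ominus>\<^bsub>P\<^esub> l) \<in> star_square A"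
      using e.star_square_image_subset by blast
    then show "counit A x \<in> star_square A"
      using x l' by (simp add: a_minus_def)
  next
    assume "counit A x \<in> star_square A"
    then have "counit A x \<in> counit A ` star_square P"
      by (simp only: e.star_square_image[OF surjs(1)])
    then obtain p where p: "counit A x = counit A p" "p \<in> star_square P"
      by (rule imageE)
    then have p': "p \<in> carrier P"
      using subgroup.mem_carrier[OF e.A.subgroup_star_square] by simp
    define l where "l = \<ominus>\<^bsub>P\<^esub> p \<oplus>\<^bsub>P\<^esub> x"
    have l: "l \<in> carrier P" "l \<in> L"
      using p p' x by (simp_all add: l_def e.mem_kernel)
    have "x \<ominus>\<^bsub>P\<^esub> l = p"
      using p' x by (simp add: l_def a_minus_def e.A.add.inv_mult_group e.A.add_cancel)
    then have "refl_class P x = refl_class P l"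
      using l x p by (simp add: e.A.refl_class_eq_iff)
    then show "refl_class P x \<in> boundaries0 A"
      unfolding boundaries0_eq using l(2) by (rule image_eqI)
  qed
  finally show ?thesis .
qed

section \<open>Classes in the second homology group\<close>

definition H2_class where
  "H2_class w = boundaries1 A #>\<^bsub>X1 A\<^esub> refl_class Q w"

lemma group_hom_H2_class: "group_hom ((add_monoid Q)\<lparr>carrier := cycle_reps\<rparr>) (H2 A) H2_class"
proof -
  have "group_hom ((add_monoid Q)\<lparr>carrier := cycle_reps\<rparr>) ((X1 A)\<lparr>carrier := cycles1 A\<rparr>) (refl_class Q)"
    unfolding X1_def
    by (rule group_hom.restrict_group_hom[OF d0.A.group_hom_refl_class subgroup_cycle_reps
          subgroup_cycles1[unfolded X1_def]])
       (simp add: cycles1_eq)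
  from group_hom_comp[OF this normal.group_hom_coset[OF normal_boundaries1_cycles1]]
  show ?thesis
    unfolding H2_def H2_class_def by simp
qed

lemma H2_class_surj: "H2_class ` cycle_reps = carrier (H2 A)"
proof -
  have "carrier (H2 A) = (\<lambda>z. boundaries1 A #>\<^bsub>X1 A\<^esub> z) ` cycles1 A"
    unfolding H2_def using normal.coset_surj[OF normal_boundaries1_cycles1] by simp
  then show ?thesis
    by (simp add: cycles1_eq image_image H2_class_def)
qed

text \<open>Triviality means that w - u lies in Q * Q for some u with both faces zero. Then w - u is
  in M \<inter> Q * Q = [M, Q], and D maps [M, Q] onto [L, P]; both directions are read off from
  this.\<close>

lemma H2_class_eq_one_iff:
  assumes w: "w \<in> cycle_reps"
  shows "H2_class w = \<one>\<^bsub>H2 A\<^esub> \<longleftrightarrow> D w \<in> comm_Grp P L"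
proof -
  have w': "w \<in> carrier Q" "counit P w = \<zero>\<^bsub>P\<^esub>" "D w \<in> star_square P"
    using w by (simp_all add: cycle_reps_def)
  have image_comm: "comm_Grp P L = D ` comm_Grp Q M"
    using d1.comm_Grp_image[OF surjs(4) d0.sb_kernel_subset] by (simp add: image_M)
  have "refl_class Q w \<in> cycles1 A"
    using w by (simp add: cycles1_eq)
  then have "H2_class w = \<one>\<^bsub>H2 A\<^esub> \<longleftrightarrow> refl_class Q w \<in> boundaries1 A"
    using normal.coset_eq_one_iff[OF normal_boundaries1_cycles1, of "refl_class Q w"]
    by (simp add: H2_class_def H2_def)
  also have "\<dots> \<longleftrightarrow> D w \<in> comm_Grp P L"
  proof
    assume "refl_class Q w \<in> boundaries1 A"
    then obtain u where u: "refl_class Q w = refl_class Q u" "u \<in> boundary_reps"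
      unfolding boundaries1_eq by (rule imageE)
    then have u': "u \<in> carrier Q" "counit P u = \<zero>\<^bsub>P\<^esub>" "D u = \<zero>\<^bsub>P\<^esub>"
      by (simp_all add: boundary_reps_def)
    have "w \<ominus>\<^bsub>Q\<^esub> u \<in> star_square Q"
      using u u' w' d0.A.refl_class_eq_iff by simp
    moreover have "counit P (w \<ominus>\<^bsub>Q\<^esub> u) = \<zero>\<^bsub>P\<^esub>"
      using u' w' by (simp add: a_minus_def)
    ultimately have "w \<ominus>\<^bsub>Q\<^esub> u \<in> comm_Grp Q M"
      by (rule M_inter_star_square)
    moreover have "D w = D (w \<ominus>\<^bsub>Q\<^esub> u)"
      using u' w' by (simp add: a_minus_def)
    ultimately show "D w \<in> comm_Grp P L"
      unfolding image_comm by (intro image_eqI)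
  next
    assume "D w \<in> comm_Grp P L"
    then obtain n where n: "D w = D n" "n \<in> comm_Grp Q M"
      unfolding image_comm by (rule imageE)
    have n': "n \<in> carrier Q" "counit P n = \<zero>\<^bsub>P\<^esub>"
      using subsetD[OF d0.comm_Grp_kernel_subset n(2)] by (simp_all add: d0.mem_kernel)
    have nn: "n \<in> star_square Q"
      using subsetD[OF d0.A.comm_Grp_subset_star_square[OF d0.sb_kernel_subset] n(2)] .
    \<comment> \<open>Removing \<open>n\<close> from \<open>w\<close> makes d_1 vanish and keeps d_0
      zero, within the same class modulo Q * Q.\<close>
    define u where "u = \<ominus>\<^bsub>Q\<^esub> n \<oplus>\<^bsub>Q\<^esub> w"
    have u: "u \<in> carrier Q" "u \<in> boundary_reps"
      using n n' w' by (simp_all add: u_def boundary_reps_def)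
    have "w \<ominus>\<^bsub>Q\<^esub> u = n"
      using n' w' by (simp add: u_def a_minus_def d0.A.add.inv_mult_group d0.A.add_cancel)
    then have "refl_class Q w = refl_class Q u"
      using u w' nn by (simp add: d0.A.refl_class_eq_iff)
    then show "refl_class Q w \<in> boundaries1 A"
      unfolding boundaries1_eq using u(2) by (rule image_eqI)
  qed
  finally show ?thesis .
qed

end

section \<open>The exact sequence of an extension\<close>

locale sb_extension =
  f: sb_morphism A B f + a: resolution A + b: resolution B +
  \<phi>: sb_morphism "G_obj A" "G_obj B" "fsb_map f" +
  \<Phi>: sb_morphism "G_obj (G_obj A)" "G_obj (G_obj B)" "fsb_map (fsb_map f)"
  for A :: "('a, 'm) ring_scheme" and B :: "('b, 'n) ring_scheme" and f +
  assumes surj: "f ` carrier A = carrier B"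

lemma (in sb_morphism) sb_extension:
  assumes "f ` carrier A = carrier B"
  shows "sb_extension A B f"
  using assms
  by (intro sb_extension.intro sb_extension_axioms.intro A.resolution B.resolution
      sb_morphism_axioms G_mor sb_morphism.G_mor)

context sb_extension
begin

section \<open>Naturality and the induced maps on homology\<close>

abbreviation "\<phi> \<equiv> fsb_map f"
abbreviation "\<Phi> \<equiv> fsb_map (fsb_map f)"
abbreviation "K \<equiv> sb_kernel A B f"

lemma surjs: "\<phi> ` carrier a.P = carrier b.P" "\<Phi> ` carrier a.Q = carrier b.Q"
  by (simp_all add: f.G_surj \<phi>.G_surj surj)

text \<open>The first two are naturality of the counit; the third is the first under G.\<close>

lemma natural:
  "x \<in> carrier a.P \<Longrightarrow> counit B (\<phi> x) = f (counit A x)"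
  "w \<in> carrier a.Q \<Longrightarrow> counit b.P (\<Phi> w) = \<phi> (counit a.P w)"
  "w \<in> carrier a.Q \<Longrightarrow> b.D (\<Phi> w) = \<phi> (a.D w)"
  using f.counit_natural \<phi>.counit_natural
  by (simp_all add: fsb_map_fsb_map cong: fsb_map_G_cong)

text \<open>By naturality \<phi> carries \<open>a.L\<close> into \<open>b.L\<close>, hence
  boundaries into boundaries, and \<open>quot_map_coset\<close> applies.\<close>

lemma H1_map_class: "x \<in> carrier a.P \<Longrightarrow> H1_map B f (H1_class A x) = H1_class B (\<phi> x)"
proof -
  assume x: "x \<in> carrier a.P"
  interpret h: group_hom "X0 A" "X0 B" "refl_map b.P \<phi>"
    unfolding X0_def by (rule \<phi>.group_hom_refl_map)
  have "refl_map b.P \<phi> ` boundaries0 A \<subseteq> boundaries0 B"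
    unfolding a.boundaries0_eq b.boundaries0_eq
  proof clarify
    fix l assume "l \<in> a.L"
    then have l: "l \<in> carrier a.P" "counit A l = \<zero>\<^bsub>A\<^esub>"
      by (simp_all add: a.e.mem_kernel)
    then have "\<phi> l \<in> b.L" by (simp add: b.e.mem_kernel natural)
    then show "refl_map b.P \<phi> (refl_class a.P l) \<in> refl_class b.P ` b.L"
      using l by (simp add: \<phi>.refl_map_class)
  qed
  moreover have "refl_class a.P x \<in> carrier (X0 A)"
    using x a.e.A.refl_class_closed by (simp add: X0_def)
  ultimately have "H1_map B f (boundaries0 A #>\<^bsub>X0 A\<^esub> refl_class a.P x) =
      boundaries0 B #>\<^bsub>X0 B\<^esub> refl_map b.P \<phi> (refl_class a.P x)"
    unfolding H1_map_def
    using normal_imp_subgroup[OF a.normal_boundaries0] normal_imp_subgroup[OF b.normal_boundaries0]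
    by (intro h.quot_map_coset)
  then show ?thesis
    using x by (simp add: \<phi>.refl_map_class) (simp add: H1_class_def refl_class_def)
qed

lemma cycle_reps_mapsto: "w \<in> a.cycle_reps \<Longrightarrow> \<Phi> w \<in> b.cycle_reps"
  using \<phi>.star_square_image_subset
  by (auto simp: a.cycle_reps_def b.cycle_reps_def natural)

lemma H2_map_class: "w \<in> a.cycle_reps \<Longrightarrow> H2_map B f (a.H2_class w) = b.H2_class (\<Phi> w)"
proof -
  assume "w \<in> a.cycle_reps"
  then have w: "w \<in> carrier a.Q" by (simp add: a.cycle_reps_def)
  interpret h: group_hom "X1 A" "X1 B" "refl_map b.Q \<Phi>"
    unfolding X1_def by (rule \<Phi>.group_hom_refl_map)
  have "refl_map b.Q \<Phi> ` boundaries1 A \<subseteq> boundaries1 B"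
    unfolding a.boundaries1_eq b.boundaries1_eq
  proof clarify
    fix l assume "l \<in> a.boundary_reps"
    then have l: "l \<in> carrier a.Q" "\<Phi> l \<in> b.boundary_reps"
      by (simp_all add: a.boundary_reps_def b.boundary_reps_def natural)
    then show "refl_map b.Q \<Phi> (refl_class a.Q l) \<in> refl_class b.Q ` b.boundary_reps"
      by (simp add: \<Phi>.refl_map_class)
  qed
  moreover have "refl_class a.Q w \<in> carrier (X1 A)"
    using w a.d0.A.refl_class_closed by (simp add: X1_def)
  ultimately have "H2_map B f (boundaries1 A #>\<^bsub>X1 A\<^esub> refl_class a.Q w) =
      boundaries1 B #>\<^bsub>X1 B\<^esub> refl_map b.Q \<Phi> (refl_class a.Q w)"
    unfolding H2_map_def
    using normal_imp_subgroup[OF a.normal_boundaries1] normal_imp_subgroup[OF b.normal_boundaries1]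
    by (intro h.quot_map_coset)
  then show ?thesis
    using w by (simp add: \<Phi>.refl_map_class a.H2_class_def b.H2_class_def)
qed

lemma group_H1: "group (H1 A)" "group (H1 B)"
  using a.group_hom_H1_class b.group_hom_H1_class by (simp_all add: group_hom_def)

lemma group_H2: "group (H2 A)" "group (H2 B)"
  using a.group_hom_H2_class b.group_hom_H2_class by (simp_all add: group_hom_def)

lemma group_hom_H1_map: "group_hom (H1 A) (H1 B) (H1_map B f)"
proof (rule group_hom_via_epi[OF group_H1 a.group_hom_H1_class])
  show "group_hom (add_monoid a.P) (H1 B) (\<lambda>x. H1_class B (\<phi> x))"
    by (rule group_hom_comp[OF \<phi>.add_group_hom b.group_hom_H1_class])
qed (simp_all add: a.H1_class_surj H1_map_class)

lemma group_hom_H2_map: "group_hom (H2 A) (H2 B) (H2_map B f)"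
proof (rule group_hom_via_epi[OF group_H2 a.group_hom_H2_class])
  have "group_hom ((add_monoid a.Q)\<lparr>carrier := a.cycle_reps\<rparr>)
      ((add_monoid b.Q)\<lparr>carrier := b.cycle_reps\<rparr>) \<Phi>"
    by (rule group_hom.restrict_group_hom[OF \<Phi>.add_group_hom a.subgroup_cycle_reps
          b.subgroup_cycle_reps]) (use cycle_reps_mapsto in blast)
  then show "group_hom ((add_monoid a.Q)\<lparr>carrier := a.cycle_reps\<rparr>) (H2 B)
      (\<lambda>w. b.H2_class (\<Phi> w))"
    by (rule group_hom_comp[OF _ b.group_hom_H2_class])
qed (simp_all add: a.H2_class_surj H2_map_class)

section \<open>Commutators over the preimage of the kernel\<close>

definition L' where
  "L' = {x \<in> carrier a.P. f (counit A x) = \<zero>\<^bsub>B\<^esub>}"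

lemma L'_subset: "L' \<subseteq> carrier a.P"
  by (auto simp: L'_def)

lemma subgroup_L': "subgroup L' (add_monoid a.P)"
proof -
  have "L' = kernel (add_monoid a.P) (add_monoid B) (\<lambda>x. f (counit A x))"
    by (auto simp: L'_def kernel_def)
  then show ?thesis
    using group_hom.subgroup_kernel[OF group_hom_comp[OF a.e.add_group_hom f.add_group_hom]]
    by simp
qed

lemma image_L'_\<phi>: "\<phi> ` L' = b.L"
proof
  show "\<phi> ` L' \<subseteq> b.L"
    by (auto simp: L'_def b.e.mem_kernel natural)
  show "b.L \<subseteq> \<phi> ` L'"
  proof
    fix y assume "y \<in> b.L"
    then have y: "y \<in> \<phi> ` carrier a.P" "counit B y = \<zero>\<^bsub>B\<^esub>"
      by (simp_all add: b.e.mem_kernel surjs)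
    then obtain x where "y = \<phi> x" "x \<in> carrier a.P" by (elim imageE)
    then show "y \<in> \<phi> ` L'"
      using y by (simp add: L'_def natural)
  qed
qed

lemma image_L'_counit: "counit A ` L' = K"
proof
  show "counit A ` L' \<subseteq> K"
    by (auto simp: L'_def f.mem_kernel)
  show "K \<subseteq> counit A ` L'"
  proof
    fix k assume "k \<in> K"
    then have k: "k \<in> carrier A" "f k = \<zero>\<^bsub>B\<^esub>" by (simp_all add: f.mem_kernel)
    then show "k \<in> counit A ` L'"
      by (intro image_eqI[of _ _ "fsb_var k"]) (simp_all add: L'_def f.A.counit_var)
  qed
qed

text \<open>The purpose of \<open>L'\<close>: it maps onto \<open>b.L\<close> under \<phi> and onto
  \<open>K\<close> under the counit, so the commutator ideals on both sides of the connecting map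
  are images of the single ideal [L', G A].\<close>

lemma image_comm_\<phi>: "comm_Grp b.P b.L = \<phi> ` comm_Grp a.P L'"
  using \<phi>.comm_Grp_image[OF surjs(1) L'_subset] by (simp add: image_L'_\<phi>)

lemma image_comm_counit: "comm_Grp A K = counit A ` comm_Grp a.P L'"
  using a.e.comm_Grp_image[OF a.surjs(1) L'_subset] by (simp add: image_L'_counit)

lemma comm_L'_star_square: "n \<in> comm_Grp a.P L' \<Longrightarrow> n \<in> star_square a.P"
  using a.e.A.comm_Grp_subset_star_square[OF L'_subset] by blast

lemma star_square_carrier: "u \<in> star_square a.P \<Longrightarrow> u \<in> carrier a.P"
  using subgroup.mem_carrier[OF a.e.A.subgroup_star_square] by simp

lemma star_square_diff:
  "u \<in> star_square a.P \<Longrightarrow> v \<in> star_square a.P \<Longrightarrow> \<ominus>\<^bsub>a.P\<^esub> u \<oplus>\<^bsub>a.P\<^esub> v \<in> star_square a.P"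
  using subgroup.m_closed[OF a.e.A.subgroup_star_square
      subgroup.m_inv_closed[OF a.e.A.subgroup_star_square]]
  by (simp add: a_inv_def)

text \<open>A set-theoretic section of \<open>f\<close> makes \<open>\<phi>\<close> a split epimorphism.\<close>

lemma \<phi>_kernel_inter_star_square:
  assumes "u \<in> star_square a.P" "\<phi> u = \<zero>\<^bsub>b.P\<^esub>"
  shows "u \<in> comm_Grp a.P L'"
proof -
  let ?s = "inv_into (carrier A) f"
  have s: "?s \<in> carrier B \<rightarrow> carrier A"
    using surj by (auto intro: inv_into_into)
  have "\<phi> (fsb_map ?s y) = y" if "y \<in> carrier b.P" for y
  proof -
    have "\<phi> (fsb_map ?s y) = fsb_map (\<lambda>y. y) y"
      unfolding fsb_map_fsb_map using surj
      by (intro fsb_map_G_cong[OF that]) (simp add: f_inv_into_f)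
    then show ?thesis by (simp add: fsb_map_id)
  qed
  with sb_morphism.mor[OF fsb_map_morI[OF s]] have "u \<in> comm_Grp a.P (sb_kernel a.P b.P \<phi>)"
    using assms by (rule \<phi>.split_kernel_inter_star_square)
  \<comment> \<open>Naturality of the counit puts the kernel of \<phi> inside
    \<open>L'\<close>.\<close>
  moreover have "f (counit A x) = \<zero>\<^bsub>B\<^esub>" if "x \<in> carrier a.P" "\<phi> x = \<zero>\<^bsub>b.P\<^esub>" for x
    using that natural(1)[of x] by simp
  then have "sb_kernel a.P b.P \<phi> \<subseteq> L'"
    by (auto simp: \<phi>.mem_kernel L'_def)
  ultimately show ?thesis
    using a.e.A.comm_Grp_mono by blast
qed

text \<open>Well-definedness of the connecting map. Some n in [L', G A] has the same image as u
  under \<phi>; then - n + u lies in Ker \<phi> and in G A * G A, so it is in [L', G A], and with it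
  u.\<close>

lemma counit_mem_comm_Grp:
  assumes u: "u \<in> star_square a.P" and "\<phi> u \<in> comm_Grp b.P b.L"
  shows "counit A u \<in> comm_Grp A K"
proof -
  obtain n where n: "\<phi> u = \<phi> n" "n \<in> comm_Grp a.P L'"
    using assms(2) unfolding image_comm_\<phi> by (rule imageE)
  have c: "u \<in> carrier a.P" "n \<in> carrier a.P"
    using u n comm_L'_star_square star_square_carrier by blast+
  have "\<ominus>\<^bsub>a.P\<^esub> n \<oplus>\<^bsub>a.P\<^esub> u \<in> comm_Grp a.P L'"
    using star_square_diff[OF comm_L'_star_square[OF n(2)] u] c n
    by (intro \<phi>_kernel_inter_star_square) simp_all
  then have "n \<oplus>\<^bsub>a.P\<^esub> (\<ominus>\<^bsub>a.P\<^esub> n \<oplus>\<^bsub>a.P\<^esub> u) \<in> comm_Grp a.P L'"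
    using subgroup.m_closed[OF a.e.A.subgroup_comm_Grp[OF L'_subset] n(2)] by simp
  then have "u \<in> comm_Grp a.P L'"
    using c by (simp add: a.e.A.add_cancel)
  then show ?thesis
    unfolding image_comm_counit by (rule imageI)
qed

text \<open>An arbitrary lift v of w' may have the wrong face. The discrepancy x = u - d_1 v is
  killed by \<phi>, so s_0 x is killed by \<Phi>, while d_1 s_0 x = x; adding s_0 x to v repairs the
  face.\<close>

lemma lift_along_\<Phi>:
  assumes w': "w' \<in> carrier b.Q" and u: "u \<in> carrier a.P" and eq: "b.D w' = \<phi> u"
  obtains w where "w \<in> carrier a.Q" "\<Phi> w = w'" "a.D w = u"
proof -
  obtain v where v: "v \<in> carrier a.Q" "\<Phi> v = w'"
    using w' unfolding surjs(2)[symmetric] by (elim imageE) simp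
  interpret c: sb_morphism a.P a.Q "fsb_map fsb_var" by (rule f.A.comult_mor)
  interpret c': sb_morphism b.P b.Q "fsb_map fsb_var" by (rule f.B.comult_mor)
  define x where "x = u \<oplus>\<^bsub>a.P\<^esub> \<ominus>\<^bsub>a.P\<^esub> a.D v"
  have x: "x \<in> carrier a.P" using u v by (simp add: x_def)
  have "\<phi> x = \<zero>\<^bsub>b.P\<^esub>"
    using u v eq natural(3)[of v] by (simp add: x_def)
  moreover have "\<Phi> (fsb_map fsb_var x) = fsb_map fsb_var (\<phi> x)"
    unfolding fsb_map_fsb_map by (rule arg_cong[of _ _ "\<lambda>g. fsb_map g x"]) auto
  ultimately have "\<Phi> (fsb_map fsb_var x) = \<zero>\<^bsub>b.Q\<^esub>" by simp
  moreover have "a.D (fsb_map fsb_var x) = x"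
    using x by (rule f.A.map_counit_comult)
  ultimately show ?thesis
    using x u v w'
    by (intro that[of "fsb_map fsb_var x \<oplus>\<^bsub>a.Q\<^esub> v"]) (simp_all add: x_def a.e.A.add.m_assoc)
qed

text \<open>Compared with \<open>a.cycle_reps\<close>, d_0 w need only vanish in G B. The inclusion
  of \<open>a.cycle_reps\<close> in \<open>W\<close> relates the connecting map to the map induced
  by \<open>f\<close> on H2.\<close>

definition W where
  "W = {w \<in> carrier a.Q. a.D w \<in> star_square a.P \<and> \<phi> (counit a.P w) = \<zero>\<^bsub>b.P\<^esub>}"

section \<open>The quotient K / [K, A]\<close>

lemma subgroup_K: "subgroup K (add_monoid A)"
  unfolding sb_kernel_def by (rule group_hom.subgroup_kernel[OF f.add_group_hom])

lemma comm_Grp_K_normal: "normal (comm_Grp A K) ((add_monoid A)\<lparr>carrier := K\<rparr>)"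
  by (rule group.normal_restrict_supergroup[OF f.A.add.is_group subgroup_K
        f.A.normal_comm_Grp[OF f.sb_kernel_subset] f.comm_Grp_kernel_subset])

abbreviation "cls k \<equiv> comm_Grp A K #>\<^bsub>add_monoid A\<^esub> k"

lemma group_hom_cls: "group_hom ((add_monoid A)\<lparr>carrier := K\<rparr>) (quot_comm_Grp A K) cls"
  using normal.group_hom_coset[OF comm_Grp_K_normal]
  unfolding quot_comm_Grp_def r_coset_carrier_update .

lemma cls_surj: "cls ` K = carrier (quot_comm_Grp A K)"
  using normal.coset_surj[OF comm_Grp_K_normal]
  unfolding quot_comm_Grp_def r_coset_carrier_update by simp

lemma cls_counit_surj: "(\<lambda>x. cls (counit A x)) ` L' = carrier (quot_comm_Grp A K)"
proof -
  have "(\<lambda>x. cls (counit A x)) ` L' = cls ` counit A ` L'"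
    by (simp only: image_image)
  then show ?thesis
    by (simp only: image_L'_counit cls_surj)
qed

lemma cls_eq_one_iff: "k \<in> K \<Longrightarrow> cls k = \<one>\<^bsub>quot_comm_Grp A K\<^esub> \<longleftrightarrow> k \<in> comm_Grp A K"
  using normal.coset_eq_one_iff[OF comm_Grp_K_normal, of k]
  unfolding quot_comm_Grp_def r_coset_carrier_update by simp

section \<open>Construction of the connecting map and of the map into H1(A)\<close>

lemma subgroup_W: "subgroup W (add_monoid a.Q)"
proof -
  interpret S: subgroup "star_square a.P" "add_monoid a.P" by (rule a.e.A.subgroup_star_square)
  have S_add: "x \<oplus>\<^bsub>a.P\<^esub> y \<in> star_square a.P"
    if "x \<in> star_square a.P" "y \<in> star_square a.P" for x y
    using S.m_closed[OF that] by simp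
  have S_neg: "\<ominus>\<^bsub>a.P\<^esub> x \<in> star_square a.P" if "x \<in> star_square a.P" for x
    using S.m_inv_closed[OF that] by (simp add: a_inv_def)
  show ?thesis
  proof (rule a.d0.A.add.subgroupI)
    show "W \<subseteq> carrier a.Q" by (auto simp: W_def)
    have "\<zero>\<^bsub>a.Q\<^esub> \<in> W"
      using S.one_closed by (simp add: W_def)
    then show "W \<noteq> {}" by blast
    show "\<ominus>\<^bsub>a.Q\<^esub> x \<in> W" if "x \<in> W" for x
      using that S_neg by (simp add: W_def)
    show "x \<oplus>\<^bsub>a.Q\<^esub> y \<in> W" if "x \<in> W" "y \<in> W" for x y
      using that S_add by (simp add: W_def)
  qed
qed

lemma W_\<Phi>: "w \<in> W \<Longrightarrow> \<Phi> w \<in> b.cycle_reps"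
  using \<phi>.star_square_image_subset by (auto simp: W_def b.cycle_reps_def natural)

text \<open>Both faces of w have the same counit, so by naturality \<open>f\<close> sends this
  element to the counit of \<phi> (d_0 w) = 0.\<close>

lemma W_K:
  assumes "w \<in> W"
  shows "counit A (a.D w) \<in> K"
proof -
  have w: "w \<in> carrier a.Q" "\<phi> (counit a.P w) = \<zero>\<^bsub>b.P\<^esub>"
    using assms by (simp_all add: W_def)
  have "f (counit A (a.D w)) = counit B (\<phi> (counit a.P w))"
    using w(1) by (simp add: a.faces natural)
  then show ?thesis using w by (simp add: f.mem_kernel)
qed

text \<open>The remaining condition for \<open>W\<close> follows from naturality: \<phi> (d_0 w) =
  d_0 w' = 0.\<close>

lemma b_cycle_lift:
  assumes w': "w' \<in> carrier b.Q" "counit b.P w' = \<zero>\<^bsub>b.P\<^esub>"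
    and u: "u \<in> star_square a.P" "b.D w' = \<phi> u"
  obtains w where "w \<in> W" "\<Phi> w = w'" "a.D w = u"
proof -
  obtain w where w: "w \<in> carrier a.Q" "\<Phi> w = w'" "a.D w = u"
    using lift_along_\<Phi>[OF w'(1) star_square_carrier[OF u(1)] u(2)] .
  then have "w \<in> W"
    using w' u natural(2)[of w] by (simp add: W_def)
  then show ?thesis using w by (intro that)
qed

lemma exists_connecting:
  obtains \<delta> where "group_hom (H2 B) (quot_comm_Grp A K) \<delta>"
    "\<And>w. w \<in> W \<Longrightarrow> \<delta> (b.H2_class (\<Phi> w)) = cls (counit A (a.D w))"
    "(\<lambda>w. b.H2_class (\<Phi> w)) ` W = carrier (H2 B)"
proof -
  let ?W = "(add_monoid a.Q)\<lparr>carrier := W\<rparr>"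
  have p: "group_hom ?W (H2 B) (\<lambda>w. b.H2_class (\<Phi> w))"
    using group_hom.restrict_group_hom[OF \<Phi>.add_group_hom subgroup_W b.subgroup_cycle_reps] W_\<Phi>
    by (intro group_hom_comp[OF _ b.group_hom_H2_class]) blast
  have "group_hom ?W ((add_monoid A)\<lparr>carrier := K\<rparr>) (\<lambda>w. counit A (a.D w))"
    using W_K
    by (intro group_hom.restrict_group_hom[OF group_hom_comp[OF a.d1.add_group_hom a.e.add_group_hom]]
        subgroup_W subgroup_K) blast
  then have q: "group_hom ?W (quot_comm_Grp A K) (\<lambda>w. cls (counit A (a.D w)))"
    by (rule group_hom_comp[OF _ group_hom_cls])
  have surj_p: "(\<lambda>w. b.H2_class (\<Phi> w)) ` W = carrier (H2 B)"
  proof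
    show "(\<lambda>w. b.H2_class (\<Phi> w)) ` W \<subseteq> carrier (H2 B)"
      using W_\<Phi> b.H2_class_surj by blast
    show "carrier (H2 B) \<subseteq> (\<lambda>w. b.H2_class (\<Phi> w)) ` W"
    proof
      fix y assume "y \<in> carrier (H2 B)"
      then obtain w' where w': "y = b.H2_class w'" "w' \<in> b.cycle_reps"
        unfolding b.H2_class_surj[symmetric] by (rule imageE)
      \<comment> \<open>\<phi> maps G A * G A onto G B * G B, so the face of the cycle comes from
        some \<open>u\<close> in G A * G A, as \<open>b_cycle_lift\<close> requires.\<close>
      then have w'': "w' \<in> carrier b.Q" "counit b.P w' = \<zero>\<^bsub>b.P\<^esub>" "b.D w' \<in> \<phi> ` star_square a.P"
        using \<phi>.star_square_image[OF surjs(1)] by (simp_all add: b.cycle_reps_def)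
      obtain u where u: "b.D w' = \<phi> u" "u \<in> star_square a.P"
        using w''(3) by (rule imageE)
      obtain w where "w \<in> W" "\<Phi> w = w'"
        using b_cycle_lift[OF w''(1,2) u(2,1)] .
      then show "y \<in> (\<lambda>w. b.H2_class (\<Phi> w)) ` W"
        using w'(1) by blast
    qed
  qed
  \<comment> \<open>The Hopf formula over \<open>B\<close> turns triviality of the class into
    membership of \<phi> (d_1 w) in [L, G B], which \<open>counit_mem_comm_Grp\<close> carries to
    [K, A].\<close>
  have ker: "cls (counit A (a.D w)) = \<one>\<^bsub>quot_comm_Grp A K\<^esub>"
    if w: "w \<in> carrier ?W" and one: "b.H2_class (\<Phi> w) = \<one>\<^bsub>H2 B\<^esub>" for w
  proof -
    have w: "w \<in> W" using w by simp
    then have "\<phi> (a.D w) \<in> comm_Grp b.P b.L"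
      using one b.H2_class_eq_one_iff[OF W_\<Phi>] by (simp add: natural W_def)
    then have "counit A (a.D w) \<in> comm_Grp A K"
      using w by (intro counit_mem_comm_Grp) (simp_all add: W_def)
    then show ?thesis using w by (simp add: cls_eq_one_iff W_K)
  qed
  have surj_p': "(\<lambda>w. b.H2_class (\<Phi> w)) ` carrier ?W = carrier (H2 B)"
    using surj_p by simp
  show ?thesis
  proof (rule group_hom_factor[OF p surj_p' q ker])
    fix \<delta> assume "group_hom (H2 B) (quot_comm_Grp A K) \<delta>"
      "\<And>w. w \<in> carrier ?W \<Longrightarrow> \<delta> (b.H2_class (\<Phi> w)) = cls (counit A (a.D w))"
    then show thesis using surj_p by (intro that) simp_all
  qed
qed

text \<open>Since H1(A) is presented as a quotient of G A, the map induced by the inclusion of K in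
  A is defined through preimages under the counit. It exists because [K, A] lies in A * A.\<close>

lemma exists_inclusion:
  obtains \<iota> where "group_hom (quot_comm_Grp A K) (H1 A) \<iota>"
    "\<And>x. x \<in> L' \<Longrightarrow> \<iota> (cls (counit A x)) = H1_class A x"
proof -
  let ?L = "(add_monoid a.P)\<lparr>carrier := L'\<rparr>"
  have "group_hom ?L ((add_monoid A)\<lparr>carrier := K\<rparr>) (counit A)"
    by (rule group_hom.restrict_group_hom[OF a.e.add_group_hom subgroup_L' subgroup_K])
       (simp add: image_L'_counit)
  then have p: "group_hom ?L (quot_comm_Grp A K) (\<lambda>x. cls (counit A x))"
    by (rule group_hom_comp[OF _ group_hom_cls])
  have surj_p: "(\<lambda>x. cls (counit A x)) ` carrier ?L = carrier (quot_comm_Grp A K)"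
    using cls_counit_surj by simp
  have q: "group_hom ?L (H1 A) (H1_class A)"
    by (rule group_hom.restrict_domain[OF a.group_hom_H1_class subgroup_L'])
  have ker: "H1_class A x = \<one>\<^bsub>H1 A\<^esub>"
    if x: "x \<in> carrier ?L" and one: "cls (counit A x) = \<one>\<^bsub>quot_comm_Grp A K\<^esub>" for x
  proof -
    have x: "x \<in> L'" using x by simp
    then have "counit A x \<in> K" using image_L'_counit by blast
    then have "counit A x \<in> comm_Grp A K"
      using one cls_eq_one_iff by simp
    then have "counit A x \<in> star_square A"
      using f.A.comm_Grp_subset_star_square[OF f.sb_kernel_subset] by blast
    then show ?thesis
      using x L'_subset by (simp add: a.H1_class_eq_one_iff subset_iff)
  qed
  show ?thesis
  proof (rule group_hom_factor[OF p surj_p q ker])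
    fix \<iota> assume "group_hom (quot_comm_Grp A K) (H1 A) \<iota>"
      "\<And>x. x \<in> carrier ?L \<Longrightarrow> \<iota> (cls (counit A x)) = H1_class A x"
    then show thesis by (intro that) simp_all
  qed
qed

section \<open>Exactness\<close>

lemma H2_class_add:
  assumes "u \<in> b.cycle_reps" "v \<in> b.cycle_reps"
  shows "b.H2_class (u \<oplus>\<^bsub>b.Q\<^esub> v) = b.H2_class u \<otimes>\<^bsub>H2 B\<^esub> b.H2_class v"
  using group_hom.hom_mult[OF b.group_hom_H2_class, of u v] assms by simp

lemma H1_class_add:
  assumes "u \<in> carrier a.P" "v \<in> carrier a.P"
  shows "H1_class A (u \<oplus>\<^bsub>a.P\<^esub> v) = H1_class A u \<otimes>\<^bsub>H1 A\<^esub> H1_class A v"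
  using group_hom.hom_mult[OF a.group_hom_H1_class, of u v] assms by simp

text \<open>For a cycle w over A the counit of d_1 w equals that of d_0 w = 0, so the composite is
  trivial. Conversely, an element w of \<open>W\<close> with trivial value is a cycle over A plus an
  element whose image has trivial class in H2(B).\<close>

lemma exact_H2:
  assumes \<delta>: "\<And>w. w \<in> W \<Longrightarrow> \<delta> (b.H2_class (\<Phi> w)) = cls (counit A (a.D w))"
    and surj_p: "(\<lambda>w. b.H2_class (\<Phi> w)) ` W = carrier (H2 B)"
  shows "H2_map B f ` carrier (H2 A) = kernel (H2 B) (quot_comm_Grp A K) \<delta>"
proof
  show "H2_map B f ` carrier (H2 A) \<subseteq> kernel (H2 B) (quot_comm_Grp A K) \<delta>"
    unfolding a.H2_class_surj[symmetric] image_image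
  proof (rule image_subsetI)
    fix w assume w: "w \<in> a.cycle_reps"
    then have w': "w \<in> carrier a.Q" "counit a.P w = \<zero>\<^bsub>a.P\<^esub>" "a.D w \<in> star_square a.P"
      by (simp_all add: a.cycle_reps_def)
    then have W: "w \<in> W" by (simp add: W_def)
    have "counit A (a.D w) = \<zero>\<^bsub>A\<^esub>"
      using w' by (simp add: a.faces)
    moreover have "\<zero>\<^bsub>A\<^esub> \<in> comm_Grp A K"
      using subgroup.one_closed[OF f.A.subgroup_comm_Grp[OF f.sb_kernel_subset]] by simp
    ultimately have "cls (counit A (a.D w)) = \<one>\<^bsub>quot_comm_Grp A K\<^esub>"
      using cls_eq_one_iff[OF W_K[OF W]] by simp
    then have "\<delta> (b.H2_class (\<Phi> w)) = \<one>\<^bsub>quot_comm_Grp A K\<^esub>"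
      using \<delta>[OF W] by simp
    moreover have "b.H2_class (\<Phi> w) \<in> carrier (H2 B)"
      using W surj_p by blast
    ultimately show "H2_map B f (a.H2_class w) \<in> kernel (H2 B) (quot_comm_Grp A K) \<delta>"
      using w by (simp add: H2_map_class kernel_def)
  qed
  show "kernel (H2 B) (quot_comm_Grp A K) \<delta> \<subseteq> H2_map B f ` carrier (H2 A)"
  proof
    fix y assume "y \<in> kernel (H2 B) (quot_comm_Grp A K) \<delta>"
    then have y: "y \<in> (\<lambda>w. b.H2_class (\<Phi> w)) ` W" "\<delta> y = \<one>\<^bsub>quot_comm_Grp A K\<^esub>"
      by (simp_all add: kernel_def surj_p)
    from y(1) obtain w where w: "y = b.H2_class (\<Phi> w)" "w \<in> W" by (rule imageE)
    then have w': "w \<in> carrier a.Q" "a.D w \<in> star_square a.P"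
      by (simp_all add: W_def)
    have "counit A (a.D w) \<in> comm_Grp A K"
      using y(2) \<delta>[OF w(2)] cls_eq_one_iff[OF W_K[OF w(2)]] w(1) by simp
    then obtain n where n: "counit A (a.D w) = counit A n" "n \<in> comm_Grp a.P L'"
      unfolding image_comm_counit by (rule imageE)
    have n': "n \<in> star_square a.P" "n \<in> carrier a.P"
      using n comm_L'_star_square star_square_carrier by blast+
    \<comment> \<open>The part of d_1 w outside [L', G A]: it is in G A * G A and in the kernel of
      the counit, hence the face of a cycle \<open>v\<close>.\<close>
    define l where "l = \<ominus>\<^bsub>a.P\<^esub> n \<oplus>\<^bsub>a.P\<^esub> a.D w"
    have l: "l \<in> star_square a.P" "l \<in> carrier a.P" "counit A l = \<zero>\<^bsub>A\<^esub>"
      using n n' w' star_square_diff by (simp_all add: l_def)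
    obtain v where v: "v \<in> carrier a.Q" "counit a.P v = \<zero>\<^bsub>a.P\<^esub>" "a.D v = l"
      using f.A.counit_kernel_lift[OF l(2,3)] .
    then have v_cycle: "v \<in> a.cycle_reps" using l by (simp add: a.cycle_reps_def)
    have \<Phi>v: "\<Phi> v \<in> b.cycle_reps" using v_cycle by (rule cycle_reps_mapsto)
    \<comment> \<open>The remainder has d_1 t = n in [L', G A], so by the Hopf formula \<Phi> t has
      trivial class, and y is the class of \<Phi> v.\<close>
    define t where "t = w \<oplus>\<^bsub>a.Q\<^esub> \<ominus>\<^bsub>a.Q\<^esub> v"
    have t: "t \<in> W" "t \<in> carrier a.Q" "w = t \<oplus>\<^bsub>a.Q\<^esub> v"
    proof -
      have "v \<in> W" using v l by (simp add: W_def)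
      then show "t \<in> W"
        using subgroup.m_closed[OF subgroup_W w(2) subgroup.m_inv_closed[OF subgroup_W]]
        by (simp add: t_def a_inv_def)
      show "t \<in> carrier a.Q" "w = t \<oplus>\<^bsub>a.Q\<^esub> v"
        using v w' by (simp_all add: t_def a.d0.A.add.m_assoc)
    qed
    have "a.D t = n"
      using v w' n' by (simp add: t_def l_def a.e.A.add.inv_mult_group a.e.A.add_cancel)
    then have "b.D (\<Phi> t) \<in> comm_Grp b.P b.L"
      using t(2) n(2) unfolding image_comm_\<phi> by (simp add: natural)
    then have "b.H2_class (\<Phi> t) = \<one>\<^bsub>H2 B\<^esub>"
      using b.H2_class_eq_one_iff[OF W_\<Phi>[OF t(1)]] by simp
    moreover have "b.H2_class (\<Phi> v) \<in> carrier (H2 B)"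
      using \<Phi>v b.H2_class_surj by blast
    moreover have "y = b.H2_class (\<Phi> t) \<otimes>\<^bsub>H2 B\<^esub> b.H2_class (\<Phi> v)"
      using w(1) t v H2_class_add[OF W_\<Phi>[OF t(1)] \<Phi>v] by simp
    ultimately have "y = H2_map B f (a.H2_class v)"
      using group.is_monoid[OF group_H2(2)] v_cycle by (simp add: H2_map_class monoid.l_one)
    moreover have "a.H2_class v \<in> carrier (H2 A)"
      using v_cycle a.H2_class_surj by blast
    ultimately show "y \<in> H2_map B f ` carrier (H2 A)" by (rule image_eqI)
  qed
qed

text \<open>An element k of K with trivial class in H1(A) lies in A * A, so it is the counit of some
  u in G A * G A. It remains to realise u as d_1 w with w in \<open>W\<close>.\<close>

lemma exact_quot:
  assumes \<delta>: "\<And>w. w \<in> W \<Longrightarrow> \<delta> (b.H2_class (\<Phi> w)) = cls (counit A (a.D w))"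
    and surj_p: "(\<lambda>w. b.H2_class (\<Phi> w)) ` W = carrier (H2 B)"
    and \<iota>: "\<And>x. x \<in> L' \<Longrightarrow> \<iota> (cls (counit A x)) = H1_class A x"
  shows "\<delta> ` carrier (H2 B) = kernel (quot_comm_Grp A K) (H1 A) \<iota>"
proof
  show "\<delta> ` carrier (H2 B) \<subseteq> kernel (quot_comm_Grp A K) (H1 A) \<iota>"
    unfolding surj_p[symmetric] image_image
  proof (rule image_subsetI)
    fix w assume W: "w \<in> W"
    then have w: "w \<in> carrier a.Q" "a.D w \<in> star_square a.P" by (simp_all add: W_def)
    have k: "counit A (a.D w) \<in> K" by (rule W_K[OF W])
    then have "a.D w \<in> L'" using w by (simp add: L'_def f.mem_kernel)
    moreover have "counit A (a.D w) \<in> star_square A"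
      using w(2) a.e.star_square_image_subset by blast
    ultimately have "\<iota> (cls (counit A (a.D w))) = \<one>\<^bsub>H1 A\<^esub>"
      using w by (simp add: \<iota> a.H1_class_eq_one_iff)
    moreover have "cls (counit A (a.D w)) \<in> carrier (quot_comm_Grp A K)"
      using k cls_surj by blast
    ultimately show "\<delta> (b.H2_class (\<Phi> w)) \<in> kernel (quot_comm_Grp A K) (H1 A) \<iota>"
      by (simp add: kernel_def \<delta>[OF W])
  qed
  show "kernel (quot_comm_Grp A K) (H1 A) \<iota> \<subseteq> \<delta> ` carrier (H2 B)"
  proof
    fix c assume "c \<in> kernel (quot_comm_Grp A K) (H1 A) \<iota>"
    then have c: "c \<in> cls ` K" "\<iota> c = \<one>\<^bsub>H1 A\<^esub>"
      by (simp_all add: kernel_def cls_surj)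
    from c(1) obtain k where k: "c = cls k" "k \<in> K" by (rule imageE)
    then have k': "k \<in> carrier A" "f k = \<zero>\<^bsub>B\<^esub>" by (simp_all add: f.mem_kernel)
    have "H1_class A (fsb_var k) = \<one>\<^bsub>H1 A\<^esub>"
      using \<iota>[of "fsb_var k"] k' k(1) c(2) by (simp add: L'_def f.A.counit_var)
    then have "k \<in> star_square A"
      using a.H1_class_eq_one_iff[of "fsb_var k"] k' by (simp add: f.A.counit_var)
    then have "k \<in> counit A ` star_square a.P"
      by (simp only: a.e.star_square_image[OF a.surjs(1)])
    then obtain u where u: "k = counit A u" "u \<in> star_square a.P" by (rule imageE)
    then have "\<phi> u \<in> carrier b.P" "counit B (\<phi> u) = \<zero>\<^bsub>B\<^esub>"
      using k' star_square_carrier by (simp_all add: natural)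
    \<comment> \<open>Since k is in K, \<phi> u lies in the kernel of the counit and is d_1 of some
      w' with d_0 w' = 0. As u is in G A * G A, this w' is a cycle that lifts to \<open>W\<close>
      with face u.\<close>
    then obtain w' where w': "w' \<in> carrier b.Q" "counit b.P w' = \<zero>\<^bsub>b.P\<^esub>" "b.D w' = \<phi> u"
      by (rule f.B.counit_kernel_lift)
    obtain w where w: "w \<in> W" "a.D w = u"
      using b_cycle_lift[OF w'(1,2) u(2) w'(3)] .
    have "c = \<delta> (b.H2_class (\<Phi> w))"
      using \<delta>[OF w(1)] w(2) u(1) k(1) by simp
    moreover have "b.H2_class (\<Phi> w) \<in> carrier (H2 B)"
      using w(1) surj_p by blast
    ultimately show "c \<in> \<delta> ` carrier (H2 B)" by (rule image_eqI)
  qed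
qed

text \<open>The class of x dies in H1(B) iff f (counit A x) is in B * B, which is the image of G A *
  G A. Subtracting a suitable u from x moves it into \<open>L'\<close> without changing its
  class.\<close>

lemma exact_H1:
  assumes \<iota>: "\<And>x. x \<in> L' \<Longrightarrow> \<iota> (cls (counit A x)) = H1_class A x"
  shows "\<iota> ` carrier (quot_comm_Grp A K) = kernel (H1 A) (H1 B) (H1_map B f)"
proof -
  have "\<iota> ` carrier (quot_comm_Grp A K) = H1_class A ` L'"
    unfolding cls_counit_surj[symmetric] image_image using \<iota> by (rule image_cong[OF HOL.refl])
  also have "\<dots> = kernel (H1 A) (H1 B) (H1_map B f)"
  proof
    have closed: "H1_class A x \<in> carrier (H1 A)" if "x \<in> carrier a.P" for x
      using that a.H1_class_surj by blast
    show "H1_class A ` L' \<subseteq> kernel (H1 A) (H1 B) (H1_map B f)"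
    proof (rule image_subsetI)
      fix x assume "x \<in> L'"
      then have x: "x \<in> carrier a.P" "f (counit A x) = \<zero>\<^bsub>B\<^esub>" by (simp_all add: L'_def)
      have "\<zero>\<^bsub>B\<^esub> \<in> star_square B"
        using subgroup.one_closed[OF f.B.subgroup_star_square] by simp
      then have "H1_class B (\<phi> x) = \<one>\<^bsub>H1 B\<^esub>"
        using x by (simp add: b.H1_class_eq_one_iff natural)
      then show "H1_class A x \<in> kernel (H1 A) (H1 B) (H1_map B f)"
        using x closed by (simp add: kernel_def H1_map_class)
    qed
    show "kernel (H1 A) (H1 B) (H1_map B f) \<subseteq> H1_class A ` L'"
    proof
      fix y assume "y \<in> kernel (H1 A) (H1 B) (H1_map B f)"
      then have y: "y \<in> H1_class A ` carrier a.P" "H1_map B f y = \<one>\<^bsub>H1 B\<^esub>"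
        by (simp_all add: kernel_def a.H1_class_surj)
      from y(1) obtain x where x: "y = H1_class A x" "x \<in> carrier a.P" by (rule imageE)
      have "f (counit A x) \<in> star_square B"
        using y(2) x b.H1_class_eq_one_iff[of "\<phi> x"] by (simp add: H1_map_class natural)
      then have "f (counit A x) \<in> f ` counit A ` star_square a.P"
        by (simp only: a.e.star_square_image[OF a.surjs(1)] f.star_square_image[OF surj])
      then obtain u where u: "f (counit A x) = f (counit A u)" "u \<in> star_square a.P"
        by (elim imageE) simp
      have u': "u \<in> carrier a.P" using u star_square_carrier by blast
      define x' where "x' = \<ominus>\<^bsub>a.P\<^esub> u \<oplus>\<^bsub>a.P\<^esub> x"
      have x': "x' \<in> L'" "x' \<in> carrier a.P" "x = u \<oplus>\<^bsub>a.P\<^esub> x'"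
        using x u u' by (simp_all add: x'_def L'_def a.e.A.add_cancel)
      have "H1_class A u = \<one>\<^bsub>H1 A\<^esub>"
        using u u' a.e.star_square_image_subset by (auto simp: a.H1_class_eq_one_iff)
      then have "y = H1_class A x'"
        using x(1) x' u' closed[OF x'(2)] group.is_monoid[OF group_H1(1)]
        by (simp add: H1_class_add monoid.l_one)
      then show "y \<in> H1_class A ` L'" using x'(1) by (rule image_eqI)
    qed
  qed
  finally show ?thesis .
qed

lemma H1_map_surj: "H1_map B f ` carrier (H1 A) = carrier (H1 B)"
proof -
  have "H1_map B f ` carrier (H1 A) = H1_class B ` \<phi> ` carrier a.P"
    unfolding a.H1_class_surj[symmetric] by (simp add: image_image H1_map_class)
  then show ?thesis
    by (simp only: surjs(1) b.H1_class_surj)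
qed

end

theorem theorem6p1:
  fixes A :: "'a ring" and B :: "'b ring" and f :: "'a \<Rightarrow> 'b" and K :: "'a set"
  assumes "skew_brace A" and "skew_brace B"
    and "f \<in> sb_hom A B" and "f ` carrier A = carrier B"
    and "K = sb_kernel A B f"
  shows "\<exists>\<delta> \<iota>.
      group_hom (H2 A) (H2 B) (H2_map B f) \<and>
      group_hom (H2 B) (quot_comm_Grp A K) \<delta> \<and>
      group_hom (quot_comm_Grp A K) (H1 A) \<iota> \<and>
      group_hom (H1 A) (H1 B) (H1_map B f) \<and>
      (\<forall>k \<in> K. \<forall>x \<in> carrier (G_obj A). counit A x = k \<longrightarrow>
         \<iota> (comm_Grp A K #>\<^bsub>add_monoid A\<^esub> k) = H1_class A x) \<and>
      H2_map B f ` carrier (H2 A) = kernel (H2 B) (quot_comm_Grp A K) \<delta> \<and>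
      \<delta> ` carrier (H2 B) = kernel (quot_comm_Grp A K) (H1 A) \<iota> \<and>
      \<iota> ` carrier (quot_comm_Grp A K) = kernel (H1 A) (H1 B) (H1_map B f) \<and>
      H1_map B f ` carrier (H1 A) = carrier (H1 B)"
proof -
  interpret f: sb_morphism A B f
    using assms by unfold_locales
  interpret sb_extension A B f
    by (rule f.sb_extension[OF assms(4)])
  obtain \<delta> where \<delta>: "group_hom (H2 B) (quot_comm_Grp A (sb_kernel A B f)) \<delta>"
    "\<And>w. w \<in> W \<Longrightarrow> \<delta> (b.H2_class (\<Phi> w)) = cls (counit A (a.D w))"
    "(\<lambda>w. b.H2_class (\<Phi> w)) ` W = carrier (H2 B)"
    by (rule exists_connecting) blast
  obtain \<iota> where \<iota>: "group_hom (quot_comm_Grp A (sb_kernel A B f)) (H1 A) \<iota>"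
    "\<And>x. x \<in> L' \<Longrightarrow> \<iota> (cls (counit A x)) = H1_class A x"
    by (rule exists_inclusion) blast
  \<comment> \<open>Every preimage of an element of K under the counit lies in \<open>L'\<close>, so
    the value of \<iota> may be computed from any of them.\<close>
  have "\<iota> (cls k) = H1_class A x"
    if "k \<in> sb_kernel A B f" "x \<in> carrier (G_obj A)" "counit A x = k" for k x
    using that \<iota>(2)[of x] by (simp add: L'_def f.mem_kernel)
  then show ?thesis
    unfolding assms(5)
    using group_hom_H1_map group_hom_H2_map \<delta>(1) \<iota>(1) exact_H2[OF \<delta>(2,3)]
      exact_quot[OF \<delta>(2,3) \<iota>(2)] exact_H1[OF \<iota>(2)] H1_map_surj
    by (intro exI[of _ \<delta>] exI[of _ \<iota>] conjI ballI impI)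
qed

end
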